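(* Let $G$ be a compact topological group and let $\mathcal A$ be a $G$-algebra of subsets of $G$ all having the strong Baire property. For $x,y\in G$ put $x\sim_{\mathcal A}y$ iff for every $B\in\mathcal A^d$, $x\in\varrho(B)\Leftrightarrow y\in\varrho(B)$, where $\varrho(B)=\mathrm{int}(\mathrm{cl}(B))$, and let $N_{\mathcal A}$ be the $\sim_{\mathcal A}$-class of the identity (a normal subgroup of $G$). Then the Ellis group of $S(\mathcal A)$ is isomorphic to $G/N_{\mathcal A}$.
   Context: $A$ has the strong Baire property if $\mathrm{int}(A)\cup\mathrm{int}(G\setminus A)$ is dense. A $G$-algebra of subsets of $G$ is closed under finite unions, complements and left translations. For an ultrafilter $q$ on $\mathcal P(G)$, $d_q(A)=\{h:h^{-1}A\in q\}$; $\mathcal A^d$ is the smallest $G$-algebra containing $\mathcal A$ closed under all $d_q$. $S(\mathcal A)$ is the Stone space of ultrafilters of $\mathcal A$, with $G$-action $g\cdot p=\{gA:A\in p\}$. The Ellis semigroup $E(X)$ of a compact $G$-space $X$ is the closure of $\{x\mapsto gx:g\in G\}$ in $X^X$ under composition; for any minimal left ideal $I$ and idempotent $u\in I$, $uI$ is a group whose isomorphism type (independent of choices) is the Ellis group of $X$. *)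

theory Defs
  imports "HOL-Analysis.Analysis" "HOL-Algebra.Coset"
begin

section \<open>Compact topological groups\<close>

text \<open>No separation axiom is required: \<open>compact\<close> is the covering property only.\<close>

definition compact_topological_group :: "('a, 'm) monoid_scheme \<Rightarrow> 'a topology \<Rightarrow> bool" where
  "compact_topological_group G T \<longleftrightarrow>
     group G \<and> topspace T = carrier G \<and> compact_space T \<and>
     continuous_map (prod_topology T T) T (\<lambda>(x, y). x \<otimes>\<^bsub>G\<^esub> y) \<and>
     continuous_map T T (\<lambda>x. inv\<^bsub>G\<^esub> x)"

definition strong_Baire_property :: "'a topology \<Rightarrow> 'a set \<Rightarrow> bool" where
  "strong_Baire_property T A \<longleftrightarrow>
     T closure_of (T interior_of A \<union> T interior_of (topspace T - A)) = topspace T"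

definition regularization :: "'a topology \<Rightarrow> 'a set \<Rightarrow> 'a set" where
  "regularization T B = T interior_of (T closure_of B)"

section \<open>Algebras of subsets of a group and their ultrafilters\<close>

definition G_algebra :: "('a, 'm) monoid_scheme \<Rightarrow> 'a set set \<Rightarrow> bool" where
  "G_algebra G \<A> \<longleftrightarrow>
     Sigma_Algebra.algebra (carrier G) \<A> \<and>
     (\<forall>g\<in>carrier G. \<forall>A\<in>\<A>. g <#\<^bsub>G\<^esub> A \<in> \<A>)"

definition ultrafilters_of :: "'a set \<Rightarrow> 'a set set \<Rightarrow> 'a set set set" where
  "ultrafilters_of \<Omega> \<A> = {p. p \<subseteq> \<A> \<and> {} \<notin> p \<and>
     (\<forall>A\<in>p. \<forall>B\<in>p. A \<inter> B \<in> p) \<and>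
     (\<forall>A\<in>p. \<forall>B\<in>\<A>. A \<subseteq> B \<longrightarrow> B \<in> p) \<and>
     (\<forall>A\<in>\<A>. A \<in> p \<or> \<Omega> - A \<in> p)}"

definition ultrafilter_shift ::
    "('a, 'm) monoid_scheme \<Rightarrow> 'a set set \<Rightarrow> 'a set \<Rightarrow> 'a set" where
  "ultrafilter_shift G q A = {h \<in> carrier G. (inv\<^bsub>G\<^esub> h) <#\<^bsub>G\<^esub> A \<in> q}"

definition d_closure :: "('a, 'm) monoid_scheme \<Rightarrow> 'a set set \<Rightarrow> 'a set set" where
  "d_closure G \<A> = \<Inter>{\<B>. G_algebra G \<B> \<and> \<A> \<subseteq> \<B> \<and>
     (\<forall>q\<in>ultrafilters_of (carrier G) (Pow (carrier G)).
        \<forall>B\<in>\<B>. ultrafilter_shift G q B \<in> \<B>)}"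

definition stone_topology :: "'a set \<Rightarrow> 'a set set \<Rightarrow> 'a set set topology" where
  "stone_topology \<Omega> \<A> =
     topology_generated_by ((\<lambda>A. {p \<in> ultrafilters_of \<Omega> \<A>. A \<in> p}) ` \<A>)"

definition translate_family :: "('a, 'm) monoid_scheme \<Rightarrow> 'a \<Rightarrow> 'a set set \<Rightarrow> 'a set set" where
  "translate_family G g p = (\<lambda>A. g <#\<^bsub>G\<^esub> A) ` p"

section \<open>The Ellis semigroup and its ideal groups\<close>

text \<open>
  The carrier of a space \<open>X\<close> is \<open>topspace X\<close>, so its self-maps are represented by extensional
  functions, and \<open>compose (topspace X) f h\<close> is the map sending \<open>x\<close> to \<open>f (h x)\<close>.
\<close>

definition ellis_semigroup ::
    "('a, 'm) monoid_scheme \<Rightarrow> 'x topology \<Rightarrow> ('a \<Rightarrow> 'x \<Rightarrow> 'x) \<Rightarrow> ('x \<Rightarrow> 'x) set" where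
  "ellis_semigroup G X \<phi> =
     product_topology (\<lambda>_. X) (topspace X) closure_of
       ((\<lambda>g. restrict (\<phi> g) (topspace X)) ` carrier G)"

definition left_ideal :: "('s \<Rightarrow> 's \<Rightarrow> 's) \<Rightarrow> 's set \<Rightarrow> 's set \<Rightarrow> bool" where
  "left_ideal f S I \<longleftrightarrow> I \<subseteq> S \<and> I \<noteq> {} \<and> (\<forall>s\<in>S. \<forall>x\<in>I. f s x \<in> I)"

definition minimal_left_ideal :: "('s \<Rightarrow> 's \<Rightarrow> 's) \<Rightarrow> 's set \<Rightarrow> 's set \<Rightarrow> bool" where
  "minimal_left_ideal f S I \<longleftrightarrow>
     left_ideal f S I \<and> (\<forall>J. left_ideal f S J \<longrightarrow> J \<subseteq> I \<longrightarrow> J = I)"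

definition ideal_group :: "('s \<Rightarrow> 's \<Rightarrow> 's) \<Rightarrow> 's set \<Rightarrow> 's \<Rightarrow> 's monoid" where
  "ideal_group f I u = \<lparr>carrier = f u ` I, mult = f, one = u\<rparr>"

text \<open>
  The group \<open>K\<close> is isomorphic to the Ellis group of \<open>X\<close>. Since the latter is only defined up to
  isomorphism, every choice of a minimal left ideal \<open>I\<close> and an idempotent \<open>u\<close> in it is required
  to give a group isomorphic to \<open>K\<close>; the first conjunct excludes the vacuous case that no such
  choice exists.
\<close>

definition ellis_group_iso ::
    "('a, 'm) monoid_scheme \<Rightarrow> 'x topology \<Rightarrow> ('a \<Rightarrow> 'x \<Rightarrow> 'x) \<Rightarrow> ('k, 'n) monoid_scheme \<Rightarrow> bool" where
  "ellis_group_iso G X \<phi> K \<longleftrightarrow>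
     (let E = ellis_semigroup G X \<phi>; c = compose (topspace X) in
       (\<exists>I u. minimal_left_ideal c E I \<and> u \<in> I \<and> c u u = u) \<and>
       (\<forall>I u. minimal_left_ideal c E I \<and> u \<in> I \<and> c u u = u \<longrightarrow>
          group (ideal_group c I u) \<and> ideal_group c I u \<cong> K))"

section \<open>The equivalence relation and the normal subgroup\<close>

definition algebra_equiv ::
    "('a, 'm) monoid_scheme \<Rightarrow> 'a topology \<Rightarrow> 'a set set \<Rightarrow> 'a \<Rightarrow> 'a \<Rightarrow> bool" where
  "algebra_equiv G T \<A> x y \<longleftrightarrow>
     (\<forall>B\<in>d_closure G \<A>. x \<in> regularization T B \<longleftrightarrow> y \<in> regularization T B)"

definition N_class :: "('a, 'm) monoid_scheme \<Rightarrow> 'a topology \<Rightarrow> 'a set set \<Rightarrow> 'a set" where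
  "N_class G T \<A> = {x \<in> carrier G. algebra_equiv G T \<A> x \<one>\<^bsub>G\<^esub>}"

end

theory Submission
  imports Defs
begin

text \<open>
  Write \<open>\<rho>\<close> for the regularization, \<open>\<D>\<close> for the d-closure and \<open>p \<star> q\<close> for the convolution of ultrafilters on
  \<open>G\<close>. Every element of the Ellis semigroup is induced by an ultrafilter \<open>p\<close> on \<open>G\<close>, and it determines
  exactly the trace of \<open>p\<close> on \<open>\<D>\<close>. By compactness \<open>q\<close> converges to some \<open>c\<close>, and then \<open>\<rho> (d\<^sub>q B) = \<rho> B c\<inverse>\<close>;
  hence \<open>\<D>\<close> consists of sets with the strong Baire property. Say that \<open>p\<close> tends to \<open>a\<close> if it contains
  every \<open>B \<in> \<D>\<close> with \<open>a \<in> \<rho> B\<close>. Such a \<open>p\<close> does not see nowhere dense sets of \<open>\<D>\<close>, and \<open>a\<close> is unique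
  modulo \<open>N\<close>. The maps induced by these \<open>p\<close> form a two-sided ideal on which \<open>p \<star> q\<close> is the right translate
  of \<open>p\<close> by the limit of \<open>q\<close>. So the ideal is left simple, hence the only minimal left ideal, its
  idempotents \<open>u\<close> are the elements tending to \<open>1\<close>, and sending \<open>g\<close> to the right translate of \<open>u\<close> by \<open>g\<close>
  is a homomorphism of \<open>G\<close> onto the ideal group of \<open>u\<close> with kernel \<open>N\<close>.
\<close>

section \<open>Ultrafilters of an algebra of sets\<close>

text \<open>Membership in an ultrafilter is a Boolean homomorphism to the truth values. In this form
  it is checked by rewriting complements and intersections, which is how \<open>convolution\<close>
  is shown to give ultrafilters.\<close>

lemma ultrafilters_of_iff:
  assumes "algebra \<Omega> \<A>"
  shows "p \<in> ultrafilters_of \<Omega> \<A> \<longleftrightarrow> p \<subseteq> \<A> \<and>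
    (\<forall>A\<in>\<A>. \<Omega> - A \<in> p \<longleftrightarrow> A \<notin> p) \<and> (\<forall>A\<in>\<A>. \<forall>B\<in>\<A>. A \<inter> B \<in> p \<longleftrightarrow> A \<in> p \<and> B \<in> p)"
    (is "_ \<longleftrightarrow> ?R")
proof
  interpret algebra \<Omega> \<A> by fact
  show ?R if "p \<in> ultrafilters_of \<Omega> \<A>"
  proof -
    note p = that[unfolded ultrafilters_of_def mem_Collect_eq]
    have "A \<notin> p" if "A \<in> \<A>" "\<Omega> - A \<in> p" for A
    proof
      assume "A \<in> p"
      then have "A \<inter> (\<Omega> - A) \<in> p" using p that by blast
      then show False using p by (simp add: Diff_triv)
    qed
    moreover have "A \<in> p \<and> B \<in> p" if "A \<in> \<A>" "B \<in> \<A>" "A \<inter> B \<in> p" for A B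
      using p that by (meson Int_lower1 Int_lower2)
    ultimately show ?thesis using p by blast
  qed
  show "p \<in> ultrafilters_of \<Omega> \<A>" if ?R
  proof -
    have "{} \<notin> p"
      using that empty_sets top by (metis Diff_empty Int_empty_left)
    moreover have "B \<in> p" if "A \<in> p" "B \<in> \<A>" "A \<subseteq> B" for A B
      using that \<open>?R\<close> by (metis inf.absorb1 subsetD)
    ultimately show ?thesis using that unfolding ultrafilters_of_def by blast
  qed
qed

lemma ultrafilters_of_Diff:
  "p \<in> ultrafilters_of \<Omega> \<A> \<Longrightarrow> algebra \<Omega> \<A> \<Longrightarrow> A \<in> \<A> \<Longrightarrow> \<Omega> - A \<in> p \<longleftrightarrow> A \<notin> p"
  by (simp add: ultrafilters_of_iff)

lemma ultrafilters_of_Int: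
  "p \<in> ultrafilters_of \<Omega> \<A> \<Longrightarrow> algebra \<Omega> \<A> \<Longrightarrow> A \<in> \<A> \<Longrightarrow> B \<in> \<A> \<Longrightarrow>
    A \<inter> B \<in> p \<longleftrightarrow> A \<in> p \<and> B \<in> p"
  by (simp add: ultrafilters_of_iff)

lemma ultrafilters_of_mono:
  "p \<in> ultrafilters_of \<Omega> \<A> \<Longrightarrow> A \<in> p \<Longrightarrow> B \<in> \<A> \<Longrightarrow> A \<subseteq> B \<Longrightarrow> B \<in> p"
  by (auto simp: ultrafilters_of_def)

lemma ultrafilters_of_empty: "p \<in> ultrafilters_of \<Omega> \<A> \<Longrightarrow> {} \<notin> p"
  by (simp add: ultrafilters_of_def)

lemma ultrafilters_of_subset: "p \<in> ultrafilters_of \<Omega> \<A> \<Longrightarrow> p \<subseteq> \<A>"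
  by (simp add: ultrafilters_of_def)

lemma ultrafilters_of_carrier:
  assumes "p \<in> ultrafilters_of \<Omega> \<A>" "algebra \<Omega> \<A>"
  shows "\<Omega> \<in> p"
  using ultrafilters_of_Diff[OF assms, of "{}"] ultrafilters_of_empty[OF assms(1)] assms(2)
  by (simp add: algebra_iff_Un)

lemma ultrafilters_of_Inter:
  assumes "p \<in> ultrafilters_of \<Omega> (Pow \<Omega>)" "finite K" "K \<subseteq> p"
  shows "\<Omega> \<inter> \<Inter>K \<in> p"
  using assms(2,3)
proof (induction K)
  case empty
  then show ?case by (simp add: ultrafilters_of_carrier[OF assms(1) algebra_Pow])
next
  case (insert A K)
  have "A \<inter> (\<Omega> \<inter> \<Inter>K) \<in> p"
    using insert assms(1) unfolding ultrafilters_of_def by auto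
  then show ?case by (simp add: Int_left_commute)
qed

text \<open>Zorn's lemma gives a maximal family \<open>M\<close> with the finite intersection
  property. Maximality puts into \<open>M\<close> every set that meets all finite intersections of
  \<open>M\<close>, and the ultrafilter axioms follow from that.\<close>

lemma ultrafilter_extension:
  assumes F: "F \<subseteq> Pow \<Omega>" and fip: "\<And>K. finite K \<Longrightarrow> K \<subseteq> F \<Longrightarrow> \<Omega> \<inter> \<Inter>K \<noteq> {}"
  obtains p where "p \<in> ultrafilters_of \<Omega> (Pow \<Omega>)" "F \<subseteq> p"
proof -
  define \<Phi> where "\<Phi> = {H. F \<subseteq> H \<and> H \<subseteq> Pow \<Omega> \<and> (\<forall>K. finite K \<longrightarrow> K \<subseteq> H \<longrightarrow> \<Omega> \<inter> \<Inter>K \<noteq> {})}"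
  have "\<exists>M\<in>\<Phi>. \<forall>X\<in>\<Phi>. M \<subseteq> X \<longrightarrow> X = M"
  proof (rule subset_Zorn_nonempty)
    have "F \<in> \<Phi>" unfolding \<Phi>_def using F fip by blast
    then show "\<Phi> \<noteq> {}" by blast
    fix C assume C: "C \<noteq> {}" "subset.chain \<Phi> C"
    have "\<Omega> \<inter> \<Inter>K \<noteq> {}" if K: "finite K" "K \<subseteq> \<Union>C" for K
    proof -
      obtain H where H: "H \<in> C" "K \<subseteq> H"
        by (rule finite_subset_Union_chain[where \<A> = \<Phi> and \<B> = C and A = K]) (use K C in blast)+
      moreover have "H \<in> \<Phi>" using C(2) H(1) by (auto simp: subset_chain_def)
      ultimately show ?thesis using K(1) by (simp add: \<Phi>_def)
    qed
    moreover have "F \<subseteq> H \<and> H \<subseteq> Pow \<Omega>" if "H \<in> C" for H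
    proof -
      have "H \<in> \<Phi>" using C(2) that by (auto simp: subset_chain_def)
      then show ?thesis by (simp add: \<Phi>_def)
    qed
    then have "F \<subseteq> \<Union>C" "\<Union>C \<subseteq> Pow \<Omega>" using C(1) by blast+
    ultimately show "\<Union>C \<in> \<Phi>" by (simp add: \<Phi>_def)
  qed
  then obtain M where M: "M \<in> \<Phi>" and max: "\<forall>X\<in>\<Phi>. M \<subseteq> X \<longrightarrow> X = M" by (rule bexE)
  have fipM: "\<Omega> \<inter> \<Inter>K \<noteq> {}" if "finite K" "K \<subseteq> M" for K
    using M that by (simp add: \<Phi>_def)
  have MP: "M \<subseteq> Pow \<Omega>" "F \<subseteq> M" using M by (simp_all add: \<Phi>_def)
  have in_M: "A \<in> M" if A: "A \<subseteq> \<Omega>" and meets: "\<And>K. finite K \<Longrightarrow> K \<subseteq> M \<Longrightarrow> A \<inter> \<Inter>K \<noteq> {}" for A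
  proof -
    have "\<Omega> \<inter> \<Inter>K \<noteq> {}" if "finite K" "K \<subseteq> insert A M" for K
    proof -
      \<comment> \<open>The finite subfamily may contain \<open>A\<close> itself, while
        \<open>meets\<close> speaks of subfamilies of \<open>M\<close> only, so \<open>A\<close> is
        split off.\<close>
      have "A \<inter> \<Inter>(K - {A}) \<noteq> {}" using that by (intro meets) auto
      moreover have "A \<inter> \<Inter>(K - {A}) \<subseteq> \<Omega> \<inter> \<Inter>K" using A by blast
      ultimately show ?thesis by blast
    qed
    moreover have "F \<subseteq> insert A M" "insert A M \<subseteq> Pow \<Omega>" using MP A by blast+
    ultimately have "insert A M \<in> \<Phi>" by (simp add: \<Phi>_def)
    then show ?thesis using max by blast
  qed
  have not_in_M: "\<exists>K. finite K \<and> K \<subseteq> M \<and> A \<inter> \<Inter>K = {}" if "A \<subseteq> \<Omega>" "A \<notin> M" for A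
  proof (rule ccontr)
    assume "\<not> ?thesis"
    then have "A \<in> M" by (intro in_M that(1)) blast
    then show False using that(2) by contradiction
  qed
  have "A \<inter> B \<in> M" if "A \<in> M" "B \<in> M" for A B
  proof (rule in_M)
    fix K assume "finite K" "K \<subseteq> M"
    then have "\<Omega> \<inter> \<Inter>(insert A (insert B K)) \<noteq> {}" using that by (intro fipM) auto
    then show "A \<inter> B \<inter> \<Inter>K \<noteq> {}" by auto
  qed (use MP that in auto)
  moreover have "B \<in> M" if "A \<in> M" "B \<subseteq> \<Omega>" "A \<subseteq> B" for A B
  proof (rule in_M)
    fix K assume "finite K" "K \<subseteq> M"
    then have "\<Omega> \<inter> \<Inter>(insert A K) \<noteq> {}" using that by (intro fipM) auto
    then show "B \<inter> \<Inter>K \<noteq> {}" using that by auto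
  qed fact
  moreover have "A \<in> M \<or> \<Omega> - A \<in> M" if sub: "A \<subseteq> \<Omega>" for A
  proof (rule ccontr)
    assume neg: "\<not> ?thesis"
    obtain K where K: "finite K" "K \<subseteq> M" "A \<inter> \<Inter>K = {}"
      using not_in_M[OF sub] neg by auto
    obtain L where L: "finite L" "L \<subseteq> M" "(\<Omega> - A) \<inter> \<Inter>L = {}"
      using not_in_M[of "\<Omega> - A"] neg by auto
    have "\<Omega> \<inter> \<Inter>(K \<union> L) \<noteq> {}" using K L by (intro fipM) auto
    then show False using K(3) L(3) by auto
  qed
  moreover have "{} \<notin> M" using fipM[of "{{}}"] by auto
  ultimately have "M \<in> ultrafilters_of \<Omega> (Pow \<Omega>)"
    using MP(1) unfolding ultrafilters_of_def by simp
  then show thesis using that MP by blast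
qed

lemma ultrafilter_extension_Int:
  assumes F: "F \<subseteq> Pow \<Omega>" "F \<noteq> {}" "{} \<notin> F" and Int: "\<And>A B. A \<in> F \<Longrightarrow> B \<in> F \<Longrightarrow> A \<inter> B \<in> F"
  obtains p where "p \<in> ultrafilters_of \<Omega> (Pow \<Omega>)" "F \<subseteq> p"
proof (rule ultrafilter_extension[OF F(1)])
  fix K assume K: "finite K" "K \<subseteq> F"
  show "\<Omega> \<inter> \<Inter>K \<noteq> {}"
  proof (cases "K = {}")
    case True
    then show ?thesis using F by auto
  next
    case False
    from K(1) False K(2) have "\<Inter>K \<in> F"
    proof (induction K rule: finite_ne_induct)
      case (insert A K)
      then show ?case using Int[of A "\<Inter>K"] by simp
    qed simp
    then have "\<Inter>K \<in> Pow \<Omega>" using F(1) by (rule subsetD[rotated])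
    moreover have "\<Inter>K \<noteq> {}" using \<open>\<Inter>K \<in> F\<close> F(3) by (metis (no_types))
    ultimately show ?thesis by blast
  qed
qed

text \<open>Otherwise every point has an open neighbourhood outside \<open>p\<close>. Finitely many
  of these cover the space, so their complements belong to \<open>p\<close> and have empty
  intersection.\<close>

lemma ultrafilter_converges:
  assumes "compact_space T" "p \<in> ultrafilters_of (topspace T) (Pow (topspace T))"
  obtains c where "c \<in> topspace T" "\<And>U. openin T U \<Longrightarrow> c \<in> U \<Longrightarrow> U \<in> p"
proof (rule ccontr)
  assume "\<not> thesis"
  with that have "\<forall>c\<in>topspace T. \<exists>U. openin T U \<and> c \<in> U \<and> U \<notin> p" by blast
  then have cover: "topspace T \<subseteq> \<Union>{U. openin T U \<and> U \<notin> p}" by blast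
  have "\<exists>K. finite K \<and> K \<subseteq> {U. openin T U \<and> U \<notin> p} \<and> topspace T \<subseteq> \<Union>K"
    by (rule assms(1)[unfolded compact_space_alt, rule_format]) (use cover in simp)
  then obtain K where K: "finite K" "K \<subseteq> {U. openin T U \<and> U \<notin> p}" "topspace T \<subseteq> \<Union>K"
    by (elim exE conjE)
  have "(\<lambda>U. topspace T - U) ` K \<subseteq> p"
  proof
    fix S assume "S \<in> (\<lambda>U. topspace T - U) ` K"
    then obtain U where "S = topspace T - U" "U \<in> K" by blast
    moreover from this have "U \<notin> p" "U \<subseteq> topspace T" using K(2) openin_subset by blast+
    ultimately show "S \<in> p"
      using ultrafilters_of_Diff[OF assms(2) algebra_Pow, of U] by simp
  qed
  then have "topspace T \<inter> \<Inter>((\<lambda>U. topspace T - U) ` K) \<in> p"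
    using K(1) by (intro ultrafilters_of_Inter[OF assms(2)] finite_imageI)
  moreover have "topspace T \<inter> \<Inter>((\<lambda>U. topspace T - U) ` K) = {}" using K(3) by auto
  ultimately show False using ultrafilters_of_empty[OF assms(2)] by simp
qed

section \<open>Regularizations of sets with the strong Baire property\<close>

text \<open>The closure of \<open>A\<close> misses the open set \<open>V\<close>, and by density it
  contains whatever lies outside the closure of \<open>V\<close>. Keeping \<open>U\<close> and
  \<open>V\<close> as parameters allows explicit witnesses for intersections and preimages.\<close>

lemma regularization_eq:
  assumes "T closure_of (U \<union> V) = topspace T" "openin T V" "U \<subseteq> A" "A \<subseteq> topspace T - V"
  shows "regularization T A = topspace T - T closure_of V"
proof
  have "T closure_of A \<subseteq> topspace T - V"
    using assms(2,4) by (intro closure_of_minimal) auto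
  then show "regularization T A \<subseteq> topspace T - T closure_of V"
    unfolding regularization_def interior_of_complement[symmetric] by (rule interior_of_mono)
  have "topspace T - T closure_of V \<subseteq> T closure_of A"
    using assms(1) closure_of_mono[OF assms(3), of T] by (auto simp: closure_of_Un)
  then show "topspace T - T closure_of V \<subseteq> regularization T A"
    unfolding regularization_def by (simp add: interior_of_maximal openin_diff)
qed

lemma openin_regularization: "openin T (regularization T A)"
  by (simp add: regularization_def)

lemma regularization_empty [simp]: "regularization T {} = {}"
  by (simp add: regularization_def)

lemma interior_of_subset_regularization:
  "A \<subseteq> topspace T \<Longrightarrow> T interior_of A \<subseteq> regularization T A"
  unfolding regularization_def by (simp add: closure_of_subset interior_of_mono)

lemma strong_Baire_property_if:
  assumes "T closure_of (U \<union> V) = topspace T" "openin T U" "openin T V" "U \<subseteq> A" "A \<inter> V = {}"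
  shows "strong_Baire_property T A"
proof -
  have "U \<subseteq> T interior_of A"
    using assms by (intro interior_of_maximal) auto
  moreover have "V \<subseteq> T interior_of (topspace T - A)"
    using assms openin_subset[OF assms(3)] by (intro interior_of_maximal) auto
  ultimately
  have "T closure_of (U \<union> V) \<subseteq> T closure_of (T interior_of A \<union> T interior_of (topspace T - A))"
    by (intro closure_of_mono) auto
  then show ?thesis
    unfolding strong_Baire_property_def using assms(1) by (simp add: closure_of_subset_topspace subset_antisym del: closure_of_Un)
qed

lemma regularization_strong_Baire:
  assumes "strong_Baire_property T A" "A \<subseteq> topspace T"
  shows "regularization T A = topspace T - T closure_of (T interior_of (topspace T - A))"
proof (rule regularization_eq)
  show "T closure_of (T interior_of A \<union> T interior_of (topspace T - A)) = topspace T"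
    using assms by (simp add: strong_Baire_property_def)
qed (use assms interior_of_subset[of T A] interior_of_subset[of T "topspace T - A"] in auto)

lemma strong_Baire_property_compl:
  assumes "strong_Baire_property T A" "A \<subseteq> topspace T"
  shows "strong_Baire_property T (topspace T - A)"
  using assms unfolding strong_Baire_property_def by (simp add: double_diff Un_commute)

lemma regularization_compl:
  assumes "strong_Baire_property T A" "A \<subseteq> topspace T"
  shows "regularization T (topspace T - A) = topspace T - T closure_of (T interior_of A)"
  using regularization_strong_Baire[OF strong_Baire_property_compl[OF assms]] assms(2)
  by (simp add: double_diff)

text \<open>A dense open set meets a dense set in a dense set. The two open sets found here witness
  the strong Baire property of \<open>A \<inter> B\<close> and determine its regularization.\<close>

lemma strong_Baire_Int_dense:
  assumes A: "strong_Baire_property T A" "A \<subseteq> topspace T"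
    and B: "strong_Baire_property T B" "B \<subseteq> topspace T"
  defines "i \<equiv> \<lambda>C. T interior_of C"
  defines "j \<equiv> \<lambda>C. T interior_of (topspace T - C)"
  shows "T closure_of ((i A \<inter> i B) \<union> (j A \<union> j B)) = topspace T"
proof -
  have 1: "openin T (i A \<union> j A)" "T closure_of (i A \<union> j A) = topspace T" "T closure_of (i B \<union> j B) = topspace T"
    using A B by (auto simp: strong_Baire_property_def i_def j_def simp del: closure_of_Un)
  have "T closure_of ((i A \<union> j A) \<inter> (i B \<union> j B)) = topspace T"
    using closure_of_openin_Int_superset[of T "i A \<union> j A" "i B \<union> j B"] 1 openin_subset[OF 1(1)]
    by (simp del: closure_of_Un)
  moreover have "(i A \<union> j A) \<inter> (i B \<union> j B) \<subseteq> (i A \<inter> i B) \<union> (j A \<union> j B)" by blast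
  ultimately show ?thesis
    by (intro subset_antisym closure_of_subset_topspace) (metis closure_of_mono)
qed

text \<open>For general sets regularization does not commute with intersection, as a dense set with
  dense complement shows. Here the complement of a regularization is the closure of an open set, and
  closure commutes with the union of two such sets.\<close>

lemma
  assumes A: "strong_Baire_property T A" "A \<subseteq> topspace T"
    and B: "strong_Baire_property T B" "B \<subseteq> topspace T"
  shows strong_Baire_property_Int: "strong_Baire_property T (A \<inter> B)"
    and regularization_Int: "regularization T (A \<inter> B) = regularization T A \<inter> regularization T B"
proof -
  note dense = strong_Baire_Int_dense[OF A B]
  note sub = interior_of_subset[of T A] interior_of_subset[of T B]
    interior_of_subset[of T "topspace T - A"] interior_of_subset[of T "topspace T - B"]
  show "strong_Baire_property T (A \<inter> B)"
    by (rule strong_Baire_property_if[OF dense]) (use sub in auto)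
  have "regularization T (A \<inter> B) = topspace T -
      T closure_of (T interior_of (topspace T - A) \<union> T interior_of (topspace T - B))"
    by (rule regularization_eq[OF dense]) (use sub A B in auto)
  then show "regularization T (A \<inter> B) = regularization T A \<inter> regularization T B"
    by (auto simp: regularization_strong_Baire A B)
qed

lemma strong_Baire_property_Un:
  assumes A: "strong_Baire_property T A" "A \<subseteq> topspace T"
    and B: "strong_Baire_property T B" "B \<subseteq> topspace T"
  shows "strong_Baire_property T (A \<union> B)"
proof -
  have "A \<union> B = topspace T - ((topspace T - A) \<inter> (topspace T - B))" using A B by auto
  moreover have "strong_Baire_property T (topspace T - ((topspace T - A) \<inter> (topspace T - B)))"
    using A B by (intro strong_Baire_property_compl strong_Baire_property_Int) auto
  ultimately show ?thesis by simp
qed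

lemma strong_Baire_property_empty: "strong_Baire_property T {}"
  by (simp add: strong_Baire_property_def)

lemma preimage_closure_of:
  assumes "homeomorphic_map T T \<phi>" "S \<subseteq> topspace T"
  shows "T closure_of {x \<in> topspace T. \<phi> x \<in> S} = {x \<in> topspace T. \<phi> x \<in> T closure_of S}"
proof -
  let ?P = "\<lambda>S. {x \<in> topspace T. \<phi> x \<in> S}"
  have bij: "\<phi> ` topspace T = topspace T" "inj_on \<phi> (topspace T)"
    using assms(1) by (auto simp: homeomorphic_imp_surjective_map homeomorphic_imp_injective_map)
  have "\<phi> ` (T closure_of ?P S) = T closure_of (\<phi> ` ?P S)"
    by (rule homeomorphic_map_closure_of[OF assms(1), symmetric]) auto
  also have "\<phi> ` ?P S = S" using bij(1) assms(2) by auto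
  also have "T closure_of S = \<phi> ` ?P (T closure_of S)"
    using bij(1) closure_of_subset_topspace[of T S] by auto
  finally show ?thesis
    by (rule inj_on_image_eq_iff[THEN iffD1, OF bij(2), rotated 2])
      (auto simp: closure_of_subset_topspace)
qed

text \<open>A set between the preimages of the two interiors differs from the preimage of \<open>B\<close> by a
  nowhere dense set only.\<close>

lemma
  assumes \<phi>: "homeomorphic_map T T \<phi>" and B: "strong_Baire_property T B" "B \<subseteq> topspace T"
    and Q: "Q \<subseteq> topspace T"
    and inner: "\<And>x. x \<in> topspace T \<Longrightarrow> \<phi> x \<in> T interior_of B \<Longrightarrow> x \<in> Q"
    and outer: "\<And>x. x \<in> topspace T \<Longrightarrow> \<phi> x \<in> T interior_of (topspace T - B) \<Longrightarrow> x \<notin> Q"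
  shows strong_Baire_property_squeeze: "strong_Baire_property T Q"
    and regularization_squeeze: "regularization T Q = {x \<in> topspace T. \<phi> x \<in> regularization T B}"
proof -
  let ?P = "\<lambda>S. {x \<in> topspace T. \<phi> x \<in> S}"
  let ?i = "T interior_of B" and ?j = "T interior_of (topspace T - B)"
  have cont: "continuous_map T T \<phi>" using \<phi> by (rule homeomorphic_imp_continuous_map)
  have img: "\<phi> x \<in> topspace T" if "x \<in> topspace T" for x
    using cont that by (auto simp: continuous_map_def)
  have op: "openin T (?P ?i)" "openin T (?P ?j)"
    by (auto intro: openin_continuous_map_preimage[OF cont])
  have "?P ?i \<union> ?P ?j = ?P (?i \<union> ?j)" by auto
  then have dense: "T closure_of (?P ?i \<union> ?P ?j) = topspace T"
    using preimage_closure_of[OF \<phi>, of "?i \<union> ?j"] B img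
    by (auto simp: strong_Baire_property_def interior_of_subset_topspace simp del: closure_of_Un)
  show "strong_Baire_property T Q"
    by (rule strong_Baire_property_if[OF dense op]) (use inner outer in auto)
  have "regularization T Q = topspace T - T closure_of (?P ?j)"
    by (rule regularization_eq[OF dense op(2)]) (use inner outer Q in auto)
  also have "\<dots> = ?P (regularization T B)"
    using img by (auto simp: preimage_closure_of[OF \<phi>] interior_of_subset_topspace
        regularization_strong_Baire B)
  finally show "regularization T Q = ?P (regularization T B)" .
qed

section \<open>Convolution of ultrafilters and the Ellis semigroup\<close>

text \<open>For \<open>\<B> = Pow (carrier G)\<close> this is the product on the Stone-Cech
  compactification of the discrete group. For a smaller \<open>\<B>\<close> it lets ultrafilters on
  the whole group act on those of \<open>\<B>\<close>.\<close>

definition convolution ::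
    "('a, 'm) monoid_scheme \<Rightarrow> 'a set set \<Rightarrow> 'a set set \<Rightarrow> 'a set set \<Rightarrow> 'a set set" where
  "convolution G \<B> p q = {A \<in> \<B>. ultrafilter_shift G q A \<in> p}"

definition principal_ultrafilter :: "'a set set \<Rightarrow> 'a \<Rightarrow> 'a set set" where
  "principal_ultrafilter \<B> g = {A \<in> \<B>. g \<in> A}"

abbreviation all_ultrafilters :: "('a, 'm) monoid_scheme \<Rightarrow> 'a set set set" where
  "all_ultrafilters G \<equiv> ultrafilters_of (carrier G) (Pow (carrier G))"

lemma ultrafilters_of_subset_eq:
  assumes "p \<in> ultrafilters_of \<Omega> \<B>" "q \<in> ultrafilters_of \<Omega> \<B>" "algebra \<Omega> \<B>" "p \<subseteq> q"
  shows "p = q"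
proof
  show "q \<subseteq> p"
  proof
    fix A assume A: "A \<in> q"
    then have "A \<in> \<B>" using assms(2) ultrafilters_of_subset by blast
    then show "A \<in> p"
      using A assms ultrafilters_of_Diff[OF assms(1,3)] ultrafilters_of_Diff[OF assms(2,3)] by blast
  qed
qed fact

lemma principal_ultrafilter_in:
  assumes "algebra \<Omega> \<B>" "g \<in> \<Omega>"
  shows "principal_ultrafilter \<B> g \<in> ultrafilters_of \<Omega> \<B>"
proof -
  interpret algebra \<Omega> \<B> by fact
  show ?thesis
    unfolding ultrafilters_of_iff[OF assms(1)] using assms(2) by (auto simp: principal_ultrafilter_def)
qed

text \<open>Complements taken in \<open>\<B>\<close> keep the extension from acquiring new members
  of \<open>\<B>\<close>. Ultrafilters of a subalgebra can thus be treated as traces of ultrafilters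
  on the power set.\<close>

lemma ultrafilters_of_extend:
  assumes r: "r \<in> ultrafilters_of \<Omega> \<B>" and alg: "algebra \<Omega> \<B>"
  obtains p where "p \<in> ultrafilters_of \<Omega> (Pow \<Omega>)" "\<And>A. A \<in> \<B> \<Longrightarrow> A \<in> p \<longleftrightarrow> A \<in> r"
proof -
  interpret algebra \<Omega> \<B> by fact
  have "r \<subseteq> Pow \<Omega>" using ultrafilters_of_subset[OF r] space_closed by blast
  moreover have "r \<noteq> {}" using ultrafilters_of_carrier[OF r alg] by blast
  moreover have "A \<inter> B \<in> r" if "A \<in> r" "B \<in> r" for A B
    using r that by (simp add: ultrafilters_of_def)
  ultimately obtain p where p: "p \<in> ultrafilters_of \<Omega> (Pow \<Omega>)" "r \<subseteq> p"
    using ultrafilter_extension_Int[of r \<Omega>] ultrafilters_of_empty[OF r] by metis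
  have "A \<in> r" if "A \<in> \<B>" "A \<in> p" for A
  proof (rule ccontr)
    assume "A \<notin> r"
    then have "\<Omega> - A \<in> p" using ultrafilters_of_Diff[OF r alg that(1)] p(2) by blast
    then show False
      using ultrafilters_of_Diff[OF p(1) algebra_Pow] that space_closed by blast
  qed
  then show thesis using that[OF p(1)] p(2) by blast
qed

section \<open>Translations, shifts and convolution in a group\<close>

context group
begin

lemma l_coset_eq:
  assumes "g \<in> carrier G" "A \<subseteq> carrier G"
  shows "g <# A = {h \<in> carrier G. inv g \<otimes> h \<in> A}"
proof -
  have "h \<in> g <# A" if "h \<in> carrier G" "inv g \<otimes> h \<in> A" for h
    using that assms unfolding l_coset_def by (auto intro!: bexI[of _ "inv g \<otimes> h"] simp: inv_solve_left' m_assoc[symmetric])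
  then show ?thesis
    using assms by (auto simp: l_coset_def m_assoc[symmetric] subset_iff)
qed

lemma G_algebraD:
  assumes "G_algebra G \<B>"
  shows "algebra (carrier G) \<B>" "\<And>A. A \<in> \<B> \<Longrightarrow> A \<subseteq> carrier G"
    "\<And>g A. g \<in> carrier G \<Longrightarrow> A \<in> \<B> \<Longrightarrow> g <# A \<in> \<B>"
  using assms by (auto simp: G_algebra_def algebra_def ring_of_sets_def semiring_of_sets_def
      subset_class_def)

lemma G_algebra_Pow: "G_algebra G (Pow (carrier G))"
  by (simp add: G_algebra_def algebra_Pow l_coset_subset_G)

lemma shift_subset: "ultrafilter_shift G q A \<subseteq> carrier G"
  by (auto simp: ultrafilter_shift_def)

text \<open>Translation commutes with complements and \<open>q\<close> decides each set. Together
  with \<open>shift_Int\<close> and \<open>shift_l_coset\<close> this makes \<open>d\<^sub>q\<close>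
  a Boolean homomorphism that commutes with left translations.\<close>

lemma shift_Diff:
  assumes q: "q \<in> ultrafilters_of (carrier G) \<B>" and \<B>: "G_algebra G \<B>" and A: "A \<in> \<B>"
  shows "ultrafilter_shift G q (carrier G - A) = carrier G - ultrafilter_shift G q A"
proof -
  have "inv h <# (carrier G - A) \<in> q \<longleftrightarrow> inv h <# A \<notin> q" if "h \<in> carrier G" for h
  proof -
    have "inv h <# (carrier G - A) = carrier G - (inv h <# A)"
      using that A G_algebraD(2)[OF \<B>] by (auto simp: l_coset_eq)
    then show ?thesis
      using ultrafilters_of_Diff[OF q] G_algebraD[OF \<B>] that A by simp
  qed
  then show ?thesis by (auto simp: ultrafilter_shift_def)
qed

lemma shift_Int:
  assumes q: "q \<in> ultrafilters_of (carrier G) \<B>" and \<B>: "G_algebra G \<B>" and A: "A \<in> \<B>" "B \<in> \<B>"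
  shows "ultrafilter_shift G q (A \<inter> B) = ultrafilter_shift G q A \<inter> ultrafilter_shift G q B"
proof -
  have "inv h <# (A \<inter> B) \<in> q \<longleftrightarrow> inv h <# A \<in> q \<and> inv h <# B \<in> q" if "h \<in> carrier G" for h
  proof -
    have "inv h <# (A \<inter> B) = (inv h <# A) \<inter> (inv h <# B)"
      using that A[THEN G_algebraD(2)[OF \<B>]] by (auto simp: l_coset_eq le_infI1)
    then show ?thesis
      using ultrafilters_of_Int[OF q] G_algebraD[OF \<B>] that A by simp
  qed
  then show ?thesis by (auto simp: ultrafilter_shift_def)
qed

lemma shift_l_coset:
  assumes g: "g \<in> carrier G" and A: "A \<subseteq> carrier G"
  shows "ultrafilter_shift G q (g <# A) = g <# ultrafilter_shift G q A"
proof -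
  have "inv h <# (g <# A) = inv (inv g \<otimes> h) <# A" if "h \<in> carrier G" for h
    using that g A by (simp add: lcos_m_assoc inv_mult_group)
  then show ?thesis
    using g by (auto simp: l_coset_eq shift_subset) (auto simp: ultrafilter_shift_def)
qed

lemma convolution_in:
  assumes p: "p \<in> all_ultrafilters G" and q: "q \<in> ultrafilters_of (carrier G) \<B>" and \<B>: "G_algebra G \<B>"
  shows "convolution G \<B> p q \<in> ultrafilters_of (carrier G) \<B>"
proof -
  interpret algebra "carrier G" \<B> using \<B> by (rule G_algebraD)
  show ?thesis
    unfolding ultrafilters_of_iff[OF algebra_axioms]
    using ultrafilters_of_Diff[OF p algebra_Pow] ultrafilters_of_Int[OF p algebra_Pow]
    by (auto simp: convolution_def shift_Diff[OF q \<B>] shift_Int[OF q \<B>] shift_subset)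
qed

text \<open>Because \<open>d\<^sub>r\<close> commutes with left translations, shifting by a
  convolution is the composition of the two shifts. Associativity of convolution is a direct
  consequence.\<close>

lemma shift_convolution:
  assumes r: "r \<in> ultrafilters_of (carrier G) \<B>" and \<B>: "G_algebra G \<B>" and A: "A \<in> \<B>"
  shows "ultrafilter_shift G (convolution G \<B> q r) A = ultrafilter_shift G q (ultrafilter_shift G r A)"
  unfolding ultrafilter_shift_def[of _ "convolution G \<B> q r"] ultrafilter_shift_def[of _ q]
  using A G_algebraD[OF \<B>] by (auto simp: convolution_def shift_l_coset)

lemma convolution_assoc:
  assumes r: "r \<in> ultrafilters_of (carrier G) \<B>" and \<B>: "G_algebra G \<B>"
  shows "convolution G \<B> p (convolution G \<B> q r) = convolution G \<B> (convolution G (Pow (carrier G)) p q) r"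
  unfolding convolution_def[of G \<B> p] convolution_def[of G \<B> "convolution G (Pow (carrier G)) p q"]
  using shift_convolution[OF r \<B>] shift_subset by (auto simp: convolution_def)

text \<open>Shifts by principal ultrafilters are right translations. This is why an algebra closed
  under all shifts is invariant on the right as well.\<close>

lemma shift_principal:
  assumes g: "g \<in> carrier G" and \<B>: "G_algebra G \<B>" and A: "A \<in> \<B>"
  shows "ultrafilter_shift G (principal_ultrafilter \<B> g) A = {h \<in> carrier G. h \<otimes> g \<in> A}"
proof -
  have "inv h <# A \<in> principal_ultrafilter \<B> g \<longleftrightarrow> h \<otimes> g \<in> A" if "h \<in> carrier G" for h
    using that g G_algebraD(3)[OF \<B> inv_closed[OF that] A] G_algebraD(2)[OF \<B> A]
    by (simp add: principal_ultrafilter_def l_coset_eq)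
  then show ?thesis by (auto simp: ultrafilter_shift_def)
qed

text \<open>Identifies the action of \<open>G\<close> on the Stone space with convolution by
  principal ultrafilters, so that group elements and their limits are handled uniformly.\<close>

lemma convolution_principal:
  assumes g: "g \<in> carrier G" and r: "r \<in> ultrafilters_of (carrier G) \<B>" and \<B>: "G_algebra G \<B>"
  shows "convolution G \<B> (principal_ultrafilter (Pow (carrier G)) g) r = translate_family G g r"
proof -
  have "A \<in> translate_family G g r" if "A \<in> \<B>" "inv g <# A \<in> r" for A
  proof -
    have "A = g <# (inv g <# A)"
      using g G_algebraD(2)[OF \<B> that(1)] by (simp add: lcos_m_assoc lcos_mult_one)
    then show ?thesis using that(2) unfolding translate_family_def by blast
  qed
  moreover have "g <# A \<in> \<B> \<and> inv g <# (g <# A) \<in> r" if "A \<in> r" for A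
  proof -
    have "A \<in> \<B>" using that ultrafilters_of_subset[OF r] by blast
    moreover from this have "inv g <# (g <# A) = A"
      using g G_algebraD(2)[OF \<B>] by (simp add: lcos_m_assoc lcos_mult_one)
    ultimately show ?thesis using that g G_algebraD(3)[OF \<B>] by simp
  qed
  ultimately show ?thesis
    using g by (auto simp: convolution_def principal_ultrafilter_def ultrafilter_shift_def translate_family_def)
qed

end

text \<open>The sets generating the topology are already a base, since an algebra is closed under
  intersections; the induction follows the generation of \<open>U\<close>.\<close>

lemma openin_stone_topologyD:
  assumes "openin (stone_topology \<Omega> \<B>) U" "p \<in> U" "algebra \<Omega> \<B>"
  shows "\<exists>A\<in>p. {q \<in> ultrafilters_of \<Omega> \<B>. A \<in> q} \<subseteq> U"
proof -
  have "generate_topology_on ((\<lambda>A. {p \<in> ultrafilters_of \<Omega> \<B>. A \<in> p}) ` \<B>) U"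
    using assms(1) unfolding stone_topology_def openin_topology_generated_by_iff .
  then show ?thesis using assms(2)
  proof induction
    case (Int U V)
    then obtain A B where AB: "A \<in> p" "B \<in> p" "{q \<in> ultrafilters_of \<Omega> \<B>. A \<in> q} \<subseteq> U"
      "{q \<in> ultrafilters_of \<Omega> \<B>. B \<in> q} \<subseteq> V" by blast
    have "generate_topology_on ((\<lambda>A. {p \<in> ultrafilters_of \<Omega> \<B>. A \<in> p}) ` \<B>) U" by fact
    then have "openin (stone_topology \<Omega> \<B>) U"
      unfolding stone_topology_def openin_topology_generated_by_iff .
    then have p: "p \<in> ultrafilters_of \<Omega> \<B>"
      using Int.prems openin_subset[of "stone_topology \<Omega> \<B>" U] by (auto simp: stone_topology_def)
    then have "A \<inter> B \<in> p" "A \<in> \<B>" "B \<in> \<B>" using AB by (auto simp: ultrafilters_of_def)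
    moreover have "{q \<in> ultrafilters_of \<Omega> \<B>. A \<inter> B \<in> q} \<subseteq> U \<inter> V"
      using AB calculation ultrafilters_of_Int[OF _ assms(3)] by blast
    ultimately show ?case by blast
  next
    case (UN K)
    then show ?case by blast
  next
    case (Basis S)
    then show ?case by blast
  qed simp
qed

lemma topspace_stone_topology:
  assumes "algebra \<Omega> \<B>"
  shows "topspace (stone_topology \<Omega> \<B>) = ultrafilters_of \<Omega> \<B>"
proof -
  interpret algebra \<Omega> \<B> by fact
  show ?thesis
    using ultrafilters_of_carrier[OF _ assms] top by (auto simp: stone_topology_def)
qed

lemma openin_stone_topology_basic:
  "A \<in> \<B> \<Longrightarrow> openin (stone_topology \<Omega> \<B>) {p \<in> ultrafilters_of \<Omega> \<B>. A \<in> p}"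
  unfolding stone_topology_def by (rule topology_generated_by_Basis) blast

text \<open>The restriction makes the map extensional, as members of \<open>ellis_semigroup\<close>
  are.\<close>

definition ellis_map ::
    "('a, 'm) monoid_scheme \<Rightarrow> 'a set set \<Rightarrow> 'a set set \<Rightarrow> 'a set set \<Rightarrow> 'a set set" where
  "ellis_map G \<B> p = restrict (convolution G \<B> p) (ultrafilters_of (carrier G) \<B>)"

section \<open>The Ellis semigroup of a Stone space, described by ultrafilters on the group\<close>

context group
begin

text \<open>The map is the pointwise limit, along \<open>p\<close>, of the translations by group
  elements, and the closure of these translations contains such limits.\<close>

lemma ellis_map_in_ellis_semigroup:
  assumes p: "p \<in> all_ultrafilters G" and \<B>: "G_algebra G \<B>"
  shows "ellis_map G \<B> p \<in> ellis_semigroup G (stone_topology (carrier G) \<B>) (translate_family G)"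
proof -
  let ?X = "stone_topology (carrier G) \<B>" and ?S = "ultrafilters_of (carrier G) \<B>"
  let ?P = "product_topology (\<lambda>_. ?X) (topspace ?X)"
  let ?t = "\<lambda>g. restrict (translate_family G g) (topspace ?X)"
  have S: "topspace ?X = ?S" using G_algebraD(1)[OF \<B>] by (rule topspace_stone_topology)
  \<comment> \<open>\<open>F\<close> is \<open>p\<close> read as a filter of predicates; only the
    part of a predicate inside the carrier counts.\<close>
  define F where "F = Abs_filter (\<lambda>P. {g \<in> carrier G. P g} \<in> p)"
  note Int = ultrafilters_of_Int[OF p algebra_Pow]
  have "is_filter (\<lambda>P. {g \<in> carrier G. P g} \<in> p)"
  proof
    show "{g \<in> carrier G. True} \<in> p" using ultrafilters_of_carrier[OF p algebra_Pow] by simp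
    show "{g \<in> carrier G. P g \<and> Q g} \<in> p"
      if "{g \<in> carrier G. P g} \<in> p" "{g \<in> carrier G. Q g} \<in> p" for P Q
    proof -
      have "{g \<in> carrier G. P g \<and> Q g} = {g \<in> carrier G. P g} \<inter> {g \<in> carrier G. Q g}" by auto
      then show ?thesis using that Int by auto
    qed
    show "{g \<in> carrier G. Q g} \<in> p"
      if "\<forall>g. P g \<longrightarrow> Q g" "{g \<in> carrier G. P g} \<in> p" for P Q
      by (rule ultrafilters_of_mono[OF p that(2)]) (use that(1) in auto)
  qed
  then have F: "eventually P F \<longleftrightarrow> {g \<in> carrier G. P g} \<in> p" for P
    unfolding F_def by (rule eventually_Abs_filter)
  have "F \<noteq> bot"
    using F[of "\<lambda>_. False"] ultrafilters_of_empty[OF p] by (auto simp: trivial_limit_def)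
  have ev_carrier: "eventually P F" if "\<And>g. g \<in> carrier G \<Longrightarrow> P g" for P
    using ultrafilters_of_carrier[OF p algebra_Pow] that unfolding F by (simp cong: conj_cong)
  have t_in: "translate_family G g q \<in> ?S" if "g \<in> carrier G" "q \<in> ?S" for g q
    using convolution_principal[OF that \<B>] convolution_in[OF _ that(2) \<B>]
      principal_ultrafilter_in[OF algebra_Pow that(1)] by metis
  have "limitin ?P ?t (ellis_map G \<B> p) F"
    unfolding limitin_componentwise
  proof (intro conjI ballI)
    show "ellis_map G \<B> p \<in> extensional (topspace ?X)" by (simp add: ellis_map_def S)
    show "\<forall>\<^sub>F g in F. ?t g \<in> topspace ?P"
      by (rule ev_carrier) (auto simp: S t_in)
    fix q assume "q \<in> topspace ?X"
    then have q: "q \<in> ?S" by (simp add: S)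
    show "limitin ?X (\<lambda>g. ?t g q) (ellis_map G \<B> p q) F"
      unfolding limitin_def
    proof (intro conjI allI impI)
      show "ellis_map G \<B> p q \<in> topspace ?X"
        using q convolution_in[OF p q \<B>] by (simp add: S ellis_map_def)
      fix U assume "openin ?X U \<and> ellis_map G \<B> p q \<in> U"
      then obtain A where A: "A \<in> convolution G \<B> p q" "{r \<in> ?S. A \<in> r} \<subseteq> U"
        using openin_stone_topologyD[OF _ _ G_algebraD(1)[OF \<B>], of U] q by (auto simp: ellis_map_def)
      \<comment> \<open>The shift of \<open>A\<close> consists of the \<open>g\<close> whose
        translate of \<open>q\<close> contains \<open>A\<close>, and it belongs to \<open>p\<close>
        by definition of convolution.\<close>
      have sub: "ultrafilter_shift G q A \<subseteq> {g \<in> carrier G. ?t g q \<in> U}"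
      proof
        fix g assume "g \<in> ultrafilter_shift G q A"
        then have g: "g \<in> carrier G" "A \<in> translate_family G g q"
          using A(1) convolution_principal[OF _ q \<B>, of g] shift_subset[of q A]
          by (auto simp: convolution_def principal_ultrafilter_def)
        then show "g \<in> {g \<in> carrier G. ?t g q \<in> U}" using A(2) t_in[OF g(1) q] q by (auto simp: S)
      qed
      have "ultrafilter_shift G q A \<in> p" using A(1) by (simp add: convolution_def)
      then show "\<forall>\<^sub>F g in F. ?t g q \<in> U"
        unfolding F by (rule ultrafilters_of_mono[OF p _ _ sub]) auto
    qed
  qed
  moreover have "\<forall>\<^sub>F g in F. ?t g \<in> ?P closure_of (?t ` carrier G)"
  proof (rule ev_carrier)
    fix g assume g: "g \<in> carrier G"
    have "?t ` carrier G \<subseteq> topspace ?P" by (auto simp: S t_in)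
    then show "?t g \<in> ?P closure_of (?t ` carrier G)" using g closure_of_subset by blast
  qed
  ultimately show ?thesis
    unfolding ellis_semigroup_def
    by (rule limitin_closedin[OF _ closedin_closure_of]) (rule \<open>F \<noteq> bot\<close>)
qed

text \<open>For the inclusion from left to right, \<open>f\<close> prescribes which shifts an
  ultrafilter \<open>p\<close> inducing it has to contain. Finitely many of these have a common
  element, because \<open>f\<close> is approximated by translations, so such a \<open>p\<close>
  exists.\<close>

lemma ellis_semigroup_stone:
  assumes \<B>: "G_algebra G \<B>"
  shows "ellis_semigroup G (stone_topology (carrier G) \<B>) (translate_family G)
    = ellis_map G \<B> ` all_ultrafilters G"
proof
  let ?X = "stone_topology (carrier G) \<B>" and ?S = "ultrafilters_of (carrier G) \<B>"
  let ?P = "product_topology (\<lambda>_. ?X) (topspace ?X)"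
  let ?t = "\<lambda>g. restrict (translate_family G g) (topspace ?X)"
  have S: "topspace ?X = ?S" using G_algebraD(1)[OF \<B>] by (rule topspace_stone_topology)
  show "ellis_semigroup G ?X (translate_family G) \<subseteq> ellis_map G \<B> ` all_ultrafilters G"
  proof
    fix f assume "f \<in> ellis_semigroup G ?X (translate_family G)"
    then have f: "f \<in> topspace ?P"
      and near: "\<And>W. openin ?P W \<Longrightarrow> f \<in> W \<Longrightarrow> \<exists>g\<in>carrier G. ?t g \<in> W"
      unfolding ellis_semigroup_def in_closure_of by blast+
    have fS: "f q \<in> ?S" if "q \<in> ?S" for q using f that by (auto simp: S)
    \<comment> \<open>A pair in \<open>I\<close> is one requirement \<open>A \<in> f q\<close> on
      \<open>p\<close>, and \<open>d\<close> turns it into the set that must belong to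
      \<open>p\<close>.\<close>
    define I where "I = {(q, A). q \<in> ?S \<and> A \<in> f q}"
    define d where "d = (\<lambda>(q, A). ultrafilter_shift G q A)"
    have fip: "carrier G \<inter> \<Inter>K \<noteq> {}" if K: "finite K" "K \<subseteq> d ` I" for K
    proof -
      obtain L where L: "L \<subseteq> I" "finite L" "K = d ` L"
        using finite_subset_image[OF K] by blast
      \<comment> \<open>\<open>W\<close> collects the maps meeting the finitely many requirements in
        \<open>L\<close>. The last intersection keeps it open when \<open>L\<close> is
        empty.\<close>
      define W where "W = (\<Inter>(q, A)\<in>L. {h \<in> topspace ?P. h q \<in> {r \<in> ?S. A \<in> r}}) \<inter> topspace ?P"
      have "openin ?P {h \<in> topspace ?P. h q \<in> {r \<in> ?S. A \<in> r}}" if "(q, A) \<in> L" for q A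
      proof (rule openin_continuous_map_preimage)
        have q: "q \<in> ?S" "A \<in> f q" using that L(1) by (auto simp: I_def)
        show "continuous_map ?P ?X (\<lambda>h. h q)"
          using q(1) by (intro continuous_map_product_projection) (simp add: S)
        show "openin ?X {r \<in> ?S. A \<in> r}"
          using fS[OF q(1)] q(2) ultrafilters_of_subset by (intro openin_stone_topology_basic) blast
      qed
      then have "openin ?P W" unfolding W_def using L(2) by (intro openin_INT) auto
      moreover have "f \<in> W" using f L(1) fS by (auto simp: W_def I_def)
      ultimately obtain g where g: "g \<in> carrier G" "?t g \<in> W" using near by blast
      have "g \<in> d (q, A)" if "(q, A) \<in> L" for q A
      proof -
        have q: "q \<in> ?S" using that L(1) by (auto simp: I_def)
        moreover have "?t g q \<in> {r \<in> ?S. A \<in> r}" using g(2) that unfolding W_def by blast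
        ultimately have "A \<in> convolution G \<B> (principal_ultrafilter (Pow (carrier G)) g) q"
          using convolution_principal[OF g(1) q \<B>] by (simp add: S)
        then show ?thesis by (simp add: convolution_def principal_ultrafilter_def d_def)
      qed
      then have "g \<in> carrier G \<inter> \<Inter>K" using g(1) L(3) by auto
      then show ?thesis by blast
    qed
    have "d ` I \<subseteq> Pow (carrier G)" using shift_subset by (auto simp: d_def)
    then obtain p where p: "p \<in> all_ultrafilters G" "d ` I \<subseteq> p"
      using fip by (rule ultrafilter_extension)
    \<comment> \<open>Both sides are ultrafilters of \<open>\<B>\<close>, so one inclusion
      suffices.\<close>
    have "f q = convolution G \<B> p q" if q: "q \<in> ?S" for q
    proof (rule ultrafilters_of_subset_eq[OF fS[OF q] convolution_in[OF p(1) q \<B>] G_algebraD(1)[OF \<B>]])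
      have "A \<in> \<B> \<and> d (q, A) \<in> p" if "A \<in> f q" for A
        using that q p(2) fS[OF q] ultrafilters_of_subset by (force simp: I_def)
      then show "f q \<subseteq> convolution G \<B> p q" by (auto simp: convolution_def d_def)
    qed
    moreover have "f \<in> extensional ?S" using f by (simp add: S PiE_def)
    ultimately have "f = ellis_map G \<B> p"
      by (intro extensionalityI[of f ?S]) (auto simp: ellis_map_def)
    then show "f \<in> ellis_map G \<B> ` all_ultrafilters G" using p(1) by blast
  qed
next
  show "ellis_map G \<B> ` all_ultrafilters G
      \<subseteq> ellis_semigroup G (stone_topology (carrier G) \<B>) (translate_family G)"
    by (rule image_subsetI) (rule ellis_map_in_ellis_semigroup[OF _ \<B>])
qed

lemma compose_ellis_map:
  assumes "p \<in> all_ultrafilters G" "q \<in> all_ultrafilters G" and \<B>: "G_algebra G \<B>"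
  shows "compose (topspace (stone_topology (carrier G) \<B>)) (ellis_map G \<B> p) (ellis_map G \<B> q) =
    ellis_map G \<B> (convolution G (Pow (carrier G)) p q)"
  unfolding topspace_stone_topology[OF G_algebraD(1)[OF \<B>]]
  using convolution_in[OF assms(2) _ \<B>] convolution_assoc[OF _ \<B>]
  by (auto simp: compose_def ellis_map_def fun_eq_iff)

end

section \<open>Pointwise form of shifts, and the d-closure as an algebra\<close>

context group
begin

lemma shift_iff:
  assumes "B \<subseteq> carrier G"
  shows "h \<in> ultrafilter_shift G q B \<longleftrightarrow> h \<in> carrier G \<and> {x \<in> carrier G. h \<otimes> x \<in> B} \<in> q"
  using assms by (auto simp: ultrafilter_shift_def l_coset_eq)

lemma convolution_principal_one:
  assumes "p \<in> all_ultrafilters G"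
  shows "convolution G (Pow (carrier G)) p (principal_ultrafilter (Pow (carrier G)) \<one>) = p"
proof -
  have "{h \<in> carrier G. h \<otimes> \<one> \<in> A} = A" if "A \<subseteq> carrier G" for A
    using that by auto
  then show ?thesis
    using ultrafilters_of_subset[OF assms]
    by (auto simp: convolution_def shift_principal[OF one_closed G_algebra_Pow])
qed

lemma convolution_principal_principal:
  assumes "a \<in> carrier G" "b \<in> carrier G"
  shows "convolution G (Pow (carrier G)) (principal_ultrafilter (Pow (carrier G)) a) (principal_ultrafilter (Pow (carrier G)) b)
    = principal_ultrafilter (Pow (carrier G)) (a \<otimes> b)"
proof -
  have "ultrafilter_shift G (principal_ultrafilter (Pow (carrier G)) b) A \<in> principal_ultrafilter (Pow (carrier G)) a
      \<longleftrightarrow> a \<otimes> b \<in> A" if "A \<subseteq> carrier G" for A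
    using assms that by (auto simp: shift_principal[OF _ G_algebra_Pow])
      (auto simp: principal_ultrafilter_def)
  then show ?thesis
    unfolding convolution_def principal_ultrafilter_def[of _ "a \<otimes> b"] by auto
qed

lemma d_closure_least:
  assumes "G_algebra G \<B>" "\<A> \<subseteq> \<B>"
    "\<And>q B. q \<in> all_ultrafilters G \<Longrightarrow> B \<in> \<B> \<Longrightarrow> ultrafilter_shift G q B \<in> \<B>"
  shows "d_closure G \<A> \<subseteq> \<B>"
  unfolding d_closure_def using assms by (intro Inter_lower) blast

lemma d_closure_shift:
  "q \<in> all_ultrafilters G \<Longrightarrow> B \<in> d_closure G \<A> \<Longrightarrow> ultrafilter_shift G q B \<in> d_closure G \<A>"
  unfolding d_closure_def by blast

lemma d_closure_superset: "\<A> \<subseteq> d_closure G \<A>"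
  unfolding d_closure_def by blast

text \<open>The power set of the group is among the algebras being intersected, which keeps the
  intersection inside the carrier. The closure properties pass to intersections.\<close>

lemma d_closure_G_algebra:
  assumes "\<A> \<subseteq> Pow (carrier G)"
  shows "G_algebra G (d_closure G \<A>)"
proof -
  have "d_closure G \<A> \<subseteq> Pow (carrier G)"
    by (rule d_closure_least[OF G_algebra_Pow assms]) (simp add: shift_subset)
  moreover define M where "M = {\<B>. G_algebra G \<B> \<and> \<A> \<subseteq> \<B> \<and>
    (\<forall>q\<in>all_ultrafilters G. \<forall>B\<in>\<B>. ultrafilter_shift G q B \<in> \<B>)}"
  have D: "d_closure G \<A> = \<Inter>M" by (simp add: d_closure_def M_def)
  have "{} \<in> \<B>" "A \<in> \<B> \<Longrightarrow> carrier G - A \<in> \<B>" "A \<in> \<B> \<Longrightarrow> B \<in> \<B> \<Longrightarrow> A \<union> B \<in> \<B>"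
    "g \<in> carrier G \<Longrightarrow> A \<in> \<B> \<Longrightarrow> g <# A \<in> \<B>" if "\<B> \<in> M" for \<B> A B g
    using that by (simp_all add: M_def G_algebra_def algebra_iff_Un)
  then have "{} \<in> \<Inter>M" "\<forall>A\<in>\<Inter>M. carrier G - A \<in> \<Inter>M" "\<forall>A\<in>\<Inter>M. \<forall>B\<in>\<Inter>M. A \<union> B \<in> \<Inter>M"
    "\<forall>g\<in>carrier G. \<forall>A\<in>\<Inter>M. g <# A \<in> \<Inter>M"
    by (simp_all only: Inter_iff) (intro ballI; simp)+
  ultimately show ?thesis unfolding D G_algebra_def algebra_iff_Un by simp
qed

end

section \<open>Limits of ultrafilters modulo nowhere dense sets\<close>

locale strong_Baire_G_algebra = group G for G :: "('a, 'm) monoid_scheme" (structure) +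
  fixes T :: "'a topology" and \<A> :: "'a set set"
  assumes compact_group: "compact_topological_group G T"
    and G_algebra: "G_algebra G \<A>"
    and strong_Baire: "\<And>A. A \<in> \<A> \<Longrightarrow> strong_Baire_property T A"
begin

abbreviation "\<D> \<equiv> d_closure G \<A>"
abbreviation "\<beta> \<equiv> all_ultrafilters G"
abbreviation "\<rho> \<equiv> regularization T"
abbreviation conv (infixl "\<star>" 70) where "p \<star> q \<equiv> convolution G (Pow (carrier G)) p q"
abbreviation "pr g \<equiv> principal_ultrafilter (Pow (carrier G)) g"
abbreviation "F \<equiv> ellis_map G \<A>"
abbreviation rho_equiv (infix "\<simeq>" 50) where "x \<simeq> y \<equiv> algebra_equiv G T \<A> x y"

lemma topspace: "topspace T = carrier G"
  using compact_group by (simp add: compact_topological_group_def)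

lemma conv_in: "p \<in> \<beta> \<Longrightarrow> q \<in> \<beta> \<Longrightarrow> p \<star> q \<in> \<beta>"
  by (rule convolution_in[OF _ _ G_algebra_Pow])

lemma pr_in: "g \<in> carrier G \<Longrightarrow> pr g \<in> \<beta>"
  by (rule principal_ultrafilter_in[OF algebra_Pow])

lemma conv_assoc: "r \<in> \<beta> \<Longrightarrow> p \<star> (q \<star> r) = p \<star> q \<star> r"
  by (rule convolution_assoc[OF _ G_algebra_Pow])

lemma mem_conv_iff: "B \<subseteq> carrier G \<Longrightarrow> B \<in> p \<star> q \<longleftrightarrow> ultrafilter_shift G q B \<in> p"
  by (simp add: convolution_def)

lemma
  assumes c: "c \<in> carrier G"
  shows homeomorphic_map_left: "homeomorphic_map T T (\<lambda>h. c \<otimes> h)"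
    and homeomorphic_map_right: "homeomorphic_map T T (\<lambda>h. h \<otimes> c)"
proof -
  have mult: "continuous_map (prod_topology T T) T (\<lambda>(x, y). x \<otimes> y)"
    using compact_group by (simp add: compact_topological_group_def)
  have left: "continuous_map T T (\<lambda>h. a \<otimes> h)" and right: "continuous_map T T (\<lambda>h. h \<otimes> a)"
    if "a \<in> carrier G" for a
  proof -
    have "continuous_map T (prod_topology T T) (\<lambda>h. (a, h))" "continuous_map T (prod_topology T T) (\<lambda>h. (h, a))"
      using that by (auto intro!: continuous_map_pairedI simp: topspace)
    from this[THEN continuous_map_compose, OF mult]
    show "continuous_map T T (\<lambda>h. a \<otimes> h)" "continuous_map T T (\<lambda>h. h \<otimes> a)"
      by (simp_all add: o_def)
  qed
  have "homeomorphic_maps T T (\<lambda>h. c \<otimes> h) (\<lambda>h. inv c \<otimes> h)"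
    "homeomorphic_maps T T (\<lambda>h. h \<otimes> c) (\<lambda>h. h \<otimes> inv c)"
    using c left right by (auto simp: homeomorphic_maps_def topspace m_assoc) (simp_all add: m_assoc[symmetric])
  then show "homeomorphic_map T T (\<lambda>h. c \<otimes> h)" "homeomorphic_map T T (\<lambda>h. h \<otimes> c)"
    by (auto simp: homeomorphic_maps_map)
qed

text \<open>A relation rather than a function, since without Hausdorff separation an ultrafilter may
  converge to several points.\<close>

definition converges_to :: "'a set set \<Rightarrow> 'a \<Rightarrow> bool" where
  "converges_to q c \<longleftrightarrow> c \<in> carrier G \<and> (\<forall>U. openin T U \<longrightarrow> c \<in> U \<longrightarrow> U \<in> q)"

lemma ultrafilter_converges_to:
  assumes "q \<in> \<beta>"
  obtains c where "converges_to q c"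
  using ultrafilter_converges[of T q thesis] assms compact_group
  by (auto simp: compact_topological_group_def converges_to_def)

lemma openin_left_preimage:
  assumes "h \<in> carrier G" "openin T U"
  shows "openin T {x \<in> carrier G. h \<otimes> x \<in> U}"
  using openin_continuous_map_preimage[OF homeomorphic_imp_continuous_map[OF homeomorphic_map_left[OF assms(1)]] assms(2)]
  by (simp add: topspace)

lemma openin_right_preimage:
  assumes "h \<in> carrier G" "openin T U"
  shows "openin T {x \<in> carrier G. x \<otimes> h \<in> U}"
  using openin_continuous_map_preimage[OF homeomorphic_imp_continuous_map[OF homeomorphic_map_right[OF assms(1)]] assms(2)]
  by (simp add: topspace)

text \<open>If \<open>h \<otimes> c\<close> lies in the interior of \<open>C\<close>, the left
  translate of that interior by the inverse of \<open>h\<close> is an open neighbourhood of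
  \<open>c\<close>, so it belongs to \<open>q\<close> and puts \<open>h\<close> into the shift of
  \<open>C\<close>. Used for \<open>B\<close> and for its complement, this squeezes the shift
  between two preimages under right translation by \<open>c\<close>.\<close>

lemma
  assumes q: "q \<in> \<beta>" "converges_to q c" and B: "B \<subseteq> carrier G" "strong_Baire_property T B"
  shows strong_Baire_property_shift: "strong_Baire_property T (ultrafilter_shift G q B)"
    and regularization_shift: "\<rho> (ultrafilter_shift G q B) = {h \<in> carrier G. h \<otimes> c \<in> \<rho> B}"
proof -
  have c: "c \<in> carrier G" using q by (simp add: converges_to_def)
  have inner: "h \<in> ultrafilter_shift G q C"
    if "h \<in> carrier G" "h \<otimes> c \<in> T interior_of C" "C \<subseteq> carrier G" for h C
  proof -
    have "{x \<in> carrier G. h \<otimes> x \<in> T interior_of C} \<in> q"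
      using q(2) that c openin_left_preimage[OF that(1)] by (auto simp: converges_to_def)
    then have "{x \<in> carrier G. h \<otimes> x \<in> C} \<in> q"
      by (rule ultrafilters_of_mono[OF q(1)]) (use interior_of_subset in fastforce)+
    then show ?thesis using that by (simp add: shift_iff)
  qed
  have outer: "h \<notin> ultrafilter_shift G q B"
    if "h \<in> carrier G" "h \<otimes> c \<in> T interior_of (carrier G - B)" for h
    using inner[OF that] B shift_Diff[OF q(1) G_algebra_Pow, of B] by auto
  note squeeze = homeomorphic_map_right[OF c] B(2) B(1)[folded topspace]
    shift_subset[of q B, folded topspace]
  show "strong_Baire_property T (ultrafilter_shift G q B)"
    by (rule strong_Baire_property_squeeze[OF squeeze]) (use inner outer B in \<open>auto simp: topspace\<close>)
  show "\<rho> (ultrafilter_shift G q B) = {h \<in> carrier G. h \<otimes> c \<in> \<rho> B}"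
    using regularization_squeeze[OF squeeze] inner outer B by (auto simp: topspace)
qed

text \<open>All sets with the strong Baire property form a \<open>G\<close>-algebra closed under
  every \<open>d\<^sub>q\<close>, because by compactness every \<open>q\<close> has a limit. The
  d-closure of \<open>\<A>\<close> is therefore contained in it.\<close>

lemma strong_Baire_property_d_closure:
  assumes "B \<in> \<D>"
  shows "strong_Baire_property T B" "B \<subseteq> carrier G"
proof -
  let ?S = "{B. B \<subseteq> carrier G \<and> strong_Baire_property T B}"
  have "\<D> \<subseteq> ?S"
  proof (rule d_closure_least)
    have "algebra (carrier G) ?S"
      unfolding algebra_iff_Un
      using strong_Baire_property_compl[of T] strong_Baire_property_Un[of T]
      by (auto simp: strong_Baire_property_empty topspace)
    moreover have "g <# B \<in> ?S" if g: "g \<in> carrier G" and B: "B \<in> ?S" for g B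
    proof -
      have "strong_Baire_property T (g <# B)"
        by (rule strong_Baire_property_squeeze[OF homeomorphic_map_left[of "inv g"], of B])
          (use g B interior_of_subset[of T B] interior_of_subset[of T "carrier G - B"] in
            \<open>auto simp: topspace l_coset_eq\<close>)
      then show ?thesis using g B by (simp add: l_coset_subset_G)
    qed
    ultimately show "G_algebra G ?S" by (simp add: G_algebra_def)
    show "\<A> \<subseteq> ?S" using strong_Baire G_algebraD(2)[OF G_algebra] by blast
    fix q B assume "q \<in> \<beta>" "B \<in> ?S"
    moreover obtain c where "converges_to q c" using ultrafilter_converges_to[OF \<open>q \<in> \<beta>\<close>] .
    ultimately show "ultrafilter_shift G q B \<in> ?S"
      using strong_Baire_property_shift shift_subset by blast
  qed
  then show "strong_Baire_property T B" "B \<subseteq> carrier G" using assms by auto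
qed

lemma G_algebra_\<D>: "G_algebra G \<D>"
  using G_algebraD(2)[OF G_algebra] by (intro d_closure_G_algebra) blast

lemma \<D>_Diff: "B \<in> \<D> \<Longrightarrow> carrier G - B \<in> \<D>"
  using G_algebraD(1)[OF G_algebra_\<D>] by (simp add: algebra_iff_Un)

lemma \<D>_Int: "B \<in> \<D> \<Longrightarrow> C \<in> \<D> \<Longrightarrow> B \<inter> C \<in> \<D>"
  using G_algebraD(1)[OF G_algebra_\<D>] by (simp add: algebra_iff_Int)

lemma \<rho>_Int: "B \<in> \<D> \<Longrightarrow> C \<in> \<D> \<Longrightarrow> \<rho> (B \<inter> C) = \<rho> B \<inter> \<rho> C"
  using strong_Baire_property_d_closure by (intro regularization_Int) (auto simp: topspace)

lemma interior_subset_\<rho>: "B \<in> \<D> \<Longrightarrow> T interior_of B \<subseteq> \<rho> B"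
  using strong_Baire_property_d_closure by (intro interior_of_subset_regularization) (auto simp: topspace)

lemma \<rho>_Diff: "B \<in> \<D> \<Longrightarrow> \<rho> (carrier G - B) = carrier G - T closure_of (T interior_of B)"
  using regularization_compl[of T B] strong_Baire_property_d_closure by (simp add: topspace)

text \<open>Left translates stay in \<open>\<D>\<close> since it is a \<open>G\<close>-algebra,
  right translates since they are shifts by principal ultrafilters. The regularizations follow
  because translations are homeomorphisms.\<close>

lemma
  assumes c: "c \<in> carrier G" and B: "B \<in> \<D>"
  shows left_preimage_in_\<D>: "{x \<in> carrier G. c \<otimes> x \<in> B} \<in> \<D>"
    and \<rho>_left_preimage: "\<rho> {x \<in> carrier G. c \<otimes> x \<in> B} = {x \<in> carrier G. c \<otimes> x \<in> \<rho> B}"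
    and right_preimage_in_\<D>: "{x \<in> carrier G. x \<otimes> c \<in> B} \<in> \<D>"
    and \<rho>_right_preimage: "\<rho> {x \<in> carrier G. x \<otimes> c \<in> B} = {x \<in> carrier G. x \<otimes> c \<in> \<rho> B}"
proof -
  note B' = strong_Baire_property_d_closure[OF B]
  have "{x \<in> carrier G. c \<otimes> x \<in> B} = inv c <# B"
    using c B' by (auto simp: l_coset_eq)
  then show "{x \<in> carrier G. c \<otimes> x \<in> B} \<in> \<D>"
    using c B G_algebraD(3)[OF G_algebra_\<D>] by simp
  show "{x \<in> carrier G. x \<otimes> c \<in> B} \<in> \<D>"
    using d_closure_shift[OF pr_in[OF c] B] shift_principal[OF c G_algebra_Pow, of B] B' by simp
  note int = interior_of_subset[of T B] interior_of_subset[of T "carrier G - B"]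
  show "\<rho> {x \<in> carrier G. c \<otimes> x \<in> B} = {x \<in> carrier G. c \<otimes> x \<in> \<rho> B}"
    using regularization_squeeze[OF homeomorphic_map_left[OF c], of B "{x \<in> carrier G. c \<otimes> x \<in> B}"]
      B' int by (auto simp: topspace)
  show "\<rho> {x \<in> carrier G. x \<otimes> c \<in> B} = {x \<in> carrier G. x \<otimes> c \<in> \<rho> B}"
    using regularization_squeeze[OF homeomorphic_map_right[OF c], of B "{x \<in> carrier G. x \<otimes> c \<in> B}"]
      B' int by (auto simp: topspace)
qed

text \<open>Not the same as convergence: \<open>pr a\<close> converges to \<open>a\<close> but omits
  every \<open>B\<close> with \<open>a \<in> \<rho> B\<close> and
  \<open>a \<notin> B\<close>.\<close>

definition tends_to :: "'a set set \<Rightarrow> 'a \<Rightarrow> bool" where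
  "tends_to p a \<longleftrightarrow> p \<in> \<beta> \<and> a \<in> carrier G \<and> (\<forall>B\<in>\<D>. a \<in> \<rho> B \<longrightarrow> B \<in> p)"

text \<open>Isolates what \<open>tends_to_conv\<close> needs of a right factor. Ultrafilters
  converging to \<open>c\<close> and ultrafilters tending to \<open>c\<close> both have it.\<close>

definition shifts_by :: "'a set set \<Rightarrow> 'a \<Rightarrow> bool" where
  "shifts_by q c \<longleftrightarrow> q \<in> \<beta> \<and> c \<in> carrier G \<and>
    (\<forall>B\<in>\<D>. \<rho> (ultrafilter_shift G q B) = {h \<in> carrier G. h \<otimes> c \<in> \<rho> B})"

lemma tends_toD: "tends_to p a \<Longrightarrow> p \<in> \<beta>" "tends_to p a \<Longrightarrow> a \<in> carrier G"
  by (simp_all add: tends_to_def)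

lemma converges_to_shifts_by: "q \<in> \<beta> \<Longrightarrow> converges_to q c \<Longrightarrow> shifts_by q c"
  using regularization_shift strong_Baire_property_d_closure
  by (auto simp: shifts_by_def converges_to_def)

lemma pr_shifts_by: "c \<in> carrier G \<Longrightarrow> shifts_by (pr c) c"
  using strong_Baire_property_d_closure
  by (simp add: shifts_by_def pr_in shift_principal[OF _ G_algebra_Pow] \<rho>_right_preimage)

text \<open>The left translate of \<open>B\<close> by the inverse of \<open>h\<close> is again in
  \<open>\<D>\<close>, and \<open>c\<close> lies in its regularization.\<close>

lemma tends_to_shift:
  assumes "tends_to q c" "B \<in> \<D>" "h \<in> carrier G" "h \<otimes> c \<in> \<rho> B"
  shows "h \<in> ultrafilter_shift G q B"
proof -
  have "c \<in> \<rho> {x \<in> carrier G. h \<otimes> x \<in> B}"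
    using assms by (simp add: \<rho>_left_preimage tends_to_def)
  then have "{x \<in> carrier G. h \<otimes> x \<in> B} \<in> q"
    using assms left_preimage_in_\<D> unfolding tends_to_def by blast
  then show ?thesis using assms strong_Baire_property_d_closure by (simp add: shift_iff)
qed

lemma tends_to_right_preimage:
  assumes "tends_to p a" "B \<in> \<D>" "c \<in> carrier G" "a \<otimes> c \<in> \<rho> B"
  shows "{h \<in> carrier G. h \<otimes> c \<in> B} \<in> p"
proof -
  have "a \<in> \<rho> {h \<in> carrier G. h \<otimes> c \<in> B}"
    using assms by (simp add: \<rho>_right_preimage tends_to_def)
  then show ?thesis using assms right_preimage_in_\<D> unfolding tends_to_def by blast
qed

text \<open>Applying \<open>tends_to_shift\<close> to \<open>B\<close> and to its complement
  squeezes the shift of \<open>B\<close> between the preimages of two interiors under right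
  translation by \<open>c\<close>.\<close>

lemma tends_to_shifts_by:
  assumes q: "tends_to q c"
  shows "shifts_by q c"
  unfolding shifts_by_def
proof (intro conjI ballI)
  fix B assume B: "B \<in> \<D>"
  note B' = strong_Baire_property_d_closure[OF B]
  have "h \<in> ultrafilter_shift G q B" if "h \<in> carrier G" "h \<otimes> c \<in> T interior_of B" for h
    using tends_to_shift[OF q B that(1)] that(2) interior_subset_\<rho>[OF B] by blast
  moreover have "h \<notin> ultrafilter_shift G q B"
    if "h \<in> carrier G" "h \<otimes> c \<in> T interior_of (carrier G - B)" for h
    using tends_to_shift[OF q \<D>_Diff[OF B] that(1)] that(2) interior_subset_\<rho>[OF \<D>_Diff[OF B]]
      shift_Diff[OF tends_toD(1)[OF q] G_algebra_Pow, of B] B' by blast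
  ultimately show "\<rho> (ultrafilter_shift G q B) = {h \<in> carrier G. h \<otimes> c \<in> \<rho> B}"
    using regularization_squeeze[OF homeomorphic_map_right[OF tends_toD(2)[OF q]] B'(1)] B' shift_subset[of q B]
    by (simp add: topspace)
qed (use q tends_toD in auto)

text \<open>The point \<open>a\<close> lies in the regularization of the shift of \<open>B\<close>
  by \<open>q\<close>, and that shift is in \<open>\<D>\<close>, so \<open>p\<close> contains it.
  This makes \<open>J\<close> a right ideal.\<close>

lemma tends_to_conv:
  assumes p: "tends_to p a" and q: "shifts_by q c"
  shows "tends_to (p \<star> q) (a \<otimes> c)"
  unfolding tends_to_def
proof (intro conjI ballI impI)
  fix B assume B: "B \<in> \<D>" "a \<otimes> c \<in> \<rho> B"
  then have "a \<in> \<rho> (ultrafilter_shift G q B)"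
    using p q by (simp add: shifts_by_def tends_to_def)
  then have "ultrafilter_shift G q B \<in> p"
    using p q B d_closure_shift by (simp add: shifts_by_def tends_to_def)
  then show "B \<in> p \<star> q" using strong_Baire_property_d_closure[OF B(1)] by (simp add: mem_conv_iff)
qed (use p q conv_in in \<open>auto simp: shifts_by_def tends_to_def\<close>)

text \<open>Here the left factor merely converges. The set of \<open>h\<close> with
  \<open>h \<otimes> a \<in> \<rho> B\<close> is an open neighbourhood of \<open>c\<close>, hence in
  \<open>q\<close>, and it is contained in the shift of \<open>B\<close> by \<open>p\<close>. This
  makes \<open>J\<close> a left ideal.\<close>

lemma converges_to_conv_tends_to:
  assumes q: "q \<in> \<beta>" "converges_to q c" and p: "tends_to p a"
  shows "tends_to (q \<star> p) (c \<otimes> a)"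
  unfolding tends_to_def
proof (intro conjI ballI impI)
  have a: "a \<in> carrier G" and c: "c \<in> carrier G" using p q by (auto simp: tends_to_def converges_to_def)
  then show "c \<otimes> a \<in> carrier G" by simp
  show "q \<star> p \<in> \<beta>" using p q conv_in tends_toD by blast
  fix B assume B: "B \<in> \<D>" "c \<otimes> a \<in> \<rho> B"
  have "{h \<in> carrier G. h \<otimes> a \<in> \<rho> B} \<in> q"
    using q(2) openin_right_preimage[OF a openin_regularization] B(2) c by (auto simp: converges_to_def)
  then have "ultrafilter_shift G p B \<in> q"
    by (rule ultrafilters_of_mono[OF q(1)]) (use tends_to_shift[OF p B(1)] shift_subset in auto)
  then show "B \<in> q \<star> p" using strong_Baire_property_d_closure[OF B(1)] by (simp add: mem_conv_iff)
qed

text \<open>The difference of \<open>B\<close> and \<open>C\<close> is in \<open>\<D>\<close> with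
  empty interior, so the regularization of its complement is the whole group and \<open>p\<close>
  contains that complement.\<close>

lemma tends_to_\<rho>_cong:
  assumes p: "tends_to p a" and BC: "B \<in> \<D>" "C \<in> \<D>" "\<rho> B = \<rho> C"
  shows "B \<in> p \<longleftrightarrow> C \<in> p"
proof -
  have "C \<in> p" if BC: "B \<in> \<D>" "C \<in> \<D>" "\<rho> B = \<rho> C" "B \<in> p" for B C
  proof (rule ccontr)
    assume "C \<notin> p"
    have sub: "B \<subseteq> carrier G" "C \<subseteq> carrier G" using BC strong_Baire_property_d_closure by auto
    let ?E = "B \<inter> (carrier G - C)"
    have E: "?E \<in> \<D>" using BC \<D>_Int \<D>_Diff by blast
    have "\<rho> ?E = \<rho> C \<inter> \<rho> (carrier G - C)"
      using BC by (simp add: \<rho>_Int \<D>_Diff)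
    also have "\<dots> = \<rho> (C \<inter> (carrier G - C))"
      using BC by (intro \<rho>_Int[symmetric] \<D>_Diff)
    finally have "\<rho> ?E = {}" by simp
    then have "T interior_of ?E = {}" using interior_subset_\<rho>[OF E] by blast
    then have "a \<in> \<rho> (carrier G - ?E)"
      using \<rho>_Diff[OF E] p by (simp add: tends_to_def)
    then have "carrier G - ?E \<in> p" using p E \<D>_Diff by (simp add: tends_to_def)
    moreover have "?E \<in> p"
      using \<open>C \<notin> p\<close> BC(4) sub ultrafilters_of_Int[OF tends_toD(1)[OF p] algebra_Pow]
        ultrafilters_of_Diff[OF tends_toD(1)[OF p] algebra_Pow, of C] by simp
    ultimately show False
      using ultrafilters_of_Diff[OF tends_toD(1)[OF p] algebra_Pow, of ?E] sub by blast
  qed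
  then show ?thesis using BC by metis
qed

lemma equiv_left:
  assumes "x \<simeq> y" "g \<in> carrier G" "x \<in> carrier G" "y \<in> carrier G"
  shows "g \<otimes> x \<simeq> g \<otimes> y"
  unfolding algebra_equiv_def
proof
  fix B assume B: "B \<in> \<D>"
  have "x \<in> \<rho> {x \<in> carrier G. g \<otimes> x \<in> B} \<longleftrightarrow> y \<in> \<rho> {x \<in> carrier G. g \<otimes> x \<in> B}"
    using assms(1) left_preimage_in_\<D>[OF assms(2) B] by (simp add: algebra_equiv_def)
  then show "g \<otimes> x \<in> \<rho> B \<longleftrightarrow> g \<otimes> y \<in> \<rho> B"
    using \<rho>_left_preimage[OF assms(2) B] assms by simp
qed

text \<open>For \<open>x = b a\<inverse>\<close> the open set \<open>x \<rho> B\<close> avoids \<open>\<rho> (G - B)\<close>, since otherwise a right translate of \<open>B\<close>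
  and its complement would both lie in \<open>p\<close>; so \<open>x \<rho> B \<subseteq> \<rho> B\<close>.\<close>

lemma tends_to_unique:
  assumes p: "tends_to p a" "tends_to p b"
  shows "a \<simeq> b"
proof -
  have "b \<in> \<rho> B" if p: "tends_to p a" "tends_to p b" and B: "B \<in> \<D>" "a \<in> \<rho> B" for a b B
  proof -
    have ab: "a \<in> carrier G" "b \<in> carrier G" using p by (auto simp: tends_to_def)
    let ?V = "{h \<in> carrier G. (a \<otimes> inv b) \<otimes> h \<in> \<rho> B}"
    have open_V: "openin T ?V"
      using ab by (intro openin_left_preimage openin_regularization) simp
    have "v \<notin> \<rho> (carrier G - B)" if v: "v \<in> ?V" for v
    proof
      assume v': "v \<in> \<rho> (carrier G - B)"
      \<comment> \<open>Right translation by \<open>?c\<close> moves \<open>b\<close> to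
        \<open>v\<close> and \<open>a\<close> into \<open>\<rho> B\<close>, so both limits of
        \<open>p\<close> are tested on the same translate.\<close>
      let ?c = "inv b \<otimes> v"
      have c: "?c \<in> carrier G" "v \<in> carrier G" using v ab by auto
      let ?C = "{h \<in> carrier G. h \<otimes> ?c \<in> B}"
      have "a \<otimes> ?c \<in> \<rho> B" using v c ab by (simp add: m_assoc[symmetric])
      then have C: "?C \<in> p"
        by (rule tends_to_right_preimage[OF p(1) B(1) c(1)])
      have "b \<otimes> ?c \<in> \<rho> (carrier G - B)" using v' c ab by (simp add: m_assoc[symmetric])
      then have "{h \<in> carrier G. h \<otimes> ?c \<in> carrier G - B} \<in> p"
        by (rule tends_to_right_preimage[OF p(2) \<D>_Diff[OF B(1)] c(1)])
      moreover have "{h \<in> carrier G. h \<otimes> ?c \<in> carrier G - B} = carrier G - ?C" using c by auto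
      ultimately have "carrier G - ?C \<in> p" by simp
      then show False
        using ultrafilters_of_Diff[OF tends_toD(1)[OF p(1)] algebra_Pow, of ?C] C by blast
    qed
    then have "?V \<inter> T interior_of (carrier G - B) = {}"
      using interior_subset_\<rho>[OF \<D>_Diff[OF B(1)]] by blast
    then have "?V \<inter> T closure_of (T interior_of (carrier G - B)) = {}"
      by (simp add: openin_Int_closure_of_eq_empty[OF open_V])
    then have "?V \<subseteq> \<rho> B"
      using regularization_strong_Baire[of T B] strong_Baire_property_d_closure[OF B(1)]
      by (auto simp: topspace)
    moreover have "b \<in> ?V" using ab B(2) by (simp add: m_assoc)
    ultimately show ?thesis by blast
  qed
  from this[OF p] this[OF p(2,1)] show ?thesis by (auto simp: algebra_equiv_def)
qed

text \<open>Since \<open>\<rho>\<close> commutes with intersections on \<open>\<D>\<close> and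
  \<open>\<rho> {}\<close> is empty, the sets that \<open>u\<close> must contain are closed under
  intersection and nonempty.\<close>

lemma exists_tends_to_one: "\<exists>u. tends_to u \<one>"
proof -
  let ?F = "{B \<in> \<D>. \<one> \<in> \<rho> B}"
  have 1: "?F \<subseteq> Pow (carrier G)" using strong_Baire_property_d_closure by blast
  have "carrier G \<in> ?F"
    using \<D>_Diff[of "{}"] G_algebraD(1)[OF G_algebra_\<D>] \<rho>_Diff[of "{}"] by (simp add: algebra_iff_Un)
  then have 2: "?F \<noteq> {}" by blast
  have 3: "{} \<notin> ?F" by simp
  have 4: "A \<inter> B \<in> ?F" if "A \<in> ?F" "B \<in> ?F" for A B
    using that by (simp add: \<D>_Int \<rho>_Int)
  obtain u where "u \<in> \<beta>" "?F \<subseteq> u"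
    by (rule ultrafilter_extension_Int[OF 1 2 3 4])
  then show ?thesis unfolding tends_to_def by blast
qed

section \<open>The minimal left ideal\<close>

text \<open>From right to left, shifts of members of \<open>\<A>\<close> lie in \<open>\<D>\<close>
  once the ultrafilter of \<open>\<A>\<close> is extended to the power set. From left to right, the
  sets whose membership in \<open>p\<close> is determined by \<open>F p\<close> form a
  \<open>G\<close>-algebra that contains \<open>\<A>\<close> and is closed under shifts.\<close>

lemma ellis_map_eq_iff:
  assumes p: "p \<in> \<beta>" "p' \<in> \<beta>"
  shows "F p = F p' \<longleftrightarrow> (\<forall>B\<in>\<D>. B \<in> p \<longleftrightarrow> B \<in> p')"
proof
  assume agree: "\<forall>B\<in>\<D>. B \<in> p \<longleftrightarrow> B \<in> p'"
  have "convolution G \<A> p q = convolution G \<A> p' q"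
    if q: "q \<in> ultrafilters_of (carrier G) \<A>" for q
  proof -
    obtain q' where q': "q' \<in> \<beta>" "\<And>A. A \<in> \<A> \<Longrightarrow> A \<in> q' \<longleftrightarrow> A \<in> q"
      using ultrafilters_of_extend[OF q G_algebraD(1)[OF G_algebra]] by blast
    have "ultrafilter_shift G q A \<in> \<D>" if "A \<in> \<A>" for A
    proof -
      have "ultrafilter_shift G q A = ultrafilter_shift G q' A"
        using that q'(2) G_algebraD(3)[OF G_algebra] by (auto simp: ultrafilter_shift_def)
      moreover have "A \<in> \<D>" using that d_closure_superset by blast
      ultimately show ?thesis using d_closure_shift[OF q'(1)] by simp
    qed
    then show ?thesis using agree by (auto simp: convolution_def)
  qed
  then show "F p = F p'" by (auto simp: ellis_map_def fun_eq_iff)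
next
  assume eq: "F p = F p'"
  \<comment> \<open>The quantification over all pairs matters: closure under translations and shifts
    applies the condition to convolutions in place of \<open>p\<close> and
    \<open>p'\<close>.\<close>
  define K where "K = {B \<in> \<D>. \<forall>p\<in>\<beta>. \<forall>p'\<in>\<beta>. F p = F p' \<longrightarrow> (B \<in> p \<longleftrightarrow> B \<in> p')}"
  have KI: "B \<in> K" if "B \<in> \<D>"
    "\<And>p p'. p \<in> \<beta> \<Longrightarrow> p' \<in> \<beta> \<Longrightarrow> F p = F p' \<Longrightarrow> B \<in> p \<longleftrightarrow> B \<in> p'" for B
    unfolding K_def by (intro CollectI conjI ballI impI that)
  have K\<D>: "B \<in> \<D>" if "B \<in> K" for B using that by (simp add: K_def)
  have sub: "B \<subseteq> carrier G" if "B \<in> K" for B using strong_Baire_property_d_closure K\<D>[OF that] by simp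
  have agree: "B \<in> p \<longleftrightarrow> B \<in> p'" if "B \<in> K" "p \<in> \<beta>" "p' \<in> \<beta>" "F p = F p'" for B p p'
    using that unfolding K_def by blast
  have diff: "carrier G - A \<in> r \<longleftrightarrow> A \<notin> r" if "r \<in> \<beta>" "A \<subseteq> carrier G" for r A
    using ultrafilters_of_Diff[OF that(1) algebra_Pow] that(2) by simp
  have int: "A \<inter> B \<in> r \<longleftrightarrow> A \<in> r \<and> B \<in> r"
    if "r \<in> \<beta>" "A \<subseteq> carrier G" "B \<subseteq> carrier G" for r A B
    using ultrafilters_of_Int[OF that(1) algebra_Pow] that(2,3) by simp
  have "\<D> \<subseteq> K"
  proof (rule d_closure_least)
    have "algebra (carrier G) K"
      unfolding algebra_iff_Int
    proof (intro conjI ballI)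
      show "K \<subseteq> Pow (carrier G)" using sub by blast
      show "{} \<in> K"
        using G_algebraD(1)[OF G_algebra_\<D>] by (intro KI) (simp_all add: algebra_iff_Un ultrafilters_of_empty)
      show "carrier G - A \<in> K" if A: "A \<in> K" for A
      proof (rule KI)
        show "carrier G - A \<in> p \<longleftrightarrow> carrier G - A \<in> p'" if p: "p \<in> \<beta>" "p' \<in> \<beta>" "F p = F p'" for p p'
          unfolding diff[OF p(1) sub[OF A]] diff[OF p(2) sub[OF A]] agree[OF A p] ..
      qed (rule \<D>_Diff[OF K\<D>[OF A]])
      show "A \<inter> B \<in> K" if A: "A \<in> K" and B: "B \<in> K" for A B
      proof (rule KI)
        show "A \<inter> B \<in> p \<longleftrightarrow> A \<inter> B \<in> p'" if p: "p \<in> \<beta>" "p' \<in> \<beta>" "F p = F p'" for p p'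
          unfolding int[OF p(1) sub[OF A] sub[OF B]] int[OF p(2) sub[OF A] sub[OF B]]
            agree[OF A p] agree[OF B p] ..
      qed (rule \<D>_Int[OF K\<D>[OF A] K\<D>[OF B]])
    qed
    moreover have "g <# B \<in> K" if g: "g \<in> carrier G" and B: "B \<in> K" for g B
    proof (rule KI)
      show "g <# B \<in> \<D>" using G_algebraD(3)[OF G_algebra_\<D> g K\<D>[OF B]] .
      fix p p' assume p: "p \<in> \<beta>" "p' \<in> \<beta>" "F p = F p'"
      have g': "pr (inv g) \<in> \<beta>" using g pr_in by simp
      have "F (pr (inv g) \<star> p) = F (pr (inv g) \<star> p')"
        using p g' by (simp flip: compose_ellis_map[OF _ _ G_algebra])
      then have "B \<in> pr (inv g) \<star> p \<longleftrightarrow> B \<in> pr (inv g) \<star> p'"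
        using B p conv_in g' by (intro agree) simp_all
      moreover have "B \<in> pr (inv g) \<star> r \<longleftrightarrow> g <# B \<in> r" for r
        using sub[OF B] g by (simp add: mem_conv_iff principal_ultrafilter_def shift_subset)
          (simp add: ultrafilter_shift_def)
      ultimately show "g <# B \<in> p \<longleftrightarrow> g <# B \<in> p'" by simp
    qed
    ultimately show "G_algebra G K" by (simp add: G_algebra_def)
    show "ultrafilter_shift G q B \<in> K" if q: "q \<in> \<beta>" and B: "B \<in> K" for q B
    proof (rule KI)
      show "ultrafilter_shift G q B \<in> \<D>" using d_closure_shift[OF q K\<D>[OF B]] .
      fix p p' assume p: "p \<in> \<beta>" "p' \<in> \<beta>" "F p = F p'"
      have "F (p \<star> q) = F (p' \<star> q)"
        using p q by (simp flip: compose_ellis_map[OF _ _ G_algebra])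
      then have "B \<in> p \<star> q \<longleftrightarrow> B \<in> p' \<star> q"
        using B p q conv_in by (intro agree) simp_all
      then show "ultrafilter_shift G q B \<in> p \<longleftrightarrow> ultrafilter_shift G q B \<in> p'"
        by (simp add: mem_conv_iff[OF sub[OF B]])
    qed
    show "\<A> \<subseteq> K"
    proof
      fix A assume A: "A \<in> \<A>"
      \<comment> \<open>Evaluating \<open>F r\<close> at the principal ultrafilter of the identity
        recovers the trace of \<open>r\<close> on \<open>\<A>\<close>.\<close>
      let ?e = "principal_ultrafilter \<A> \<one>"
      have e: "?e \<in> ultrafilters_of (carrier G) \<A>"
        by (rule principal_ultrafilter_in[OF G_algebraD(1)[OF G_algebra] one_closed])
      have "{h \<in> carrier G. h \<otimes> \<one> \<in> A} = A" using G_algebraD(2)[OF G_algebra A] by auto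
      then have mem: "A \<in> F r ?e \<longleftrightarrow> A \<in> r" for r
        using e A shift_principal[OF one_closed G_algebra A]
        by (simp add: ellis_map_def convolution_def)
      show "A \<in> K"
      proof (rule KI)
        show "A \<in> \<D>" using A d_closure_superset by blast
        show "A \<in> p \<longleftrightarrow> A \<in> p'" if "F p = F p'" for p p'
          using mem[of p] mem[of p'] that by simp
      qed
    qed
  qed
  then show "\<forall>B\<in>\<D>. B \<in> p \<longleftrightarrow> B \<in> p'" using agree[OF _ p eq] by blast
qed

text \<open>The shifts of a member of \<open>\<D>\<close> by \<open>q\<close> and by
  \<open>q'\<close> have equal regularizations, and \<open>p\<close> does not distinguish such
  sets.\<close>

lemma ellis_map_conv_cong:
  assumes p: "tends_to p a" and q: "shifts_by q b" "shifts_by q' b'" and "b \<simeq> b'"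
  shows "F (p \<star> q) = F (p \<star> q')"
proof -
  have in\<beta>: "p \<in> \<beta>" "q \<in> \<beta>" "q' \<in> \<beta>" "b \<in> carrier G" "b' \<in> carrier G"
    using p q by (auto simp: tends_to_def shifts_by_def)
  have "B \<in> p \<star> q \<longleftrightarrow> B \<in> p \<star> q'" if B: "B \<in> \<D>" for B
  proof -
    have "h \<otimes> b \<in> \<rho> B \<longleftrightarrow> h \<otimes> b' \<in> \<rho> B" if "h \<in> carrier G" for h
      using equiv_left[OF assms(4) that] in\<beta> B by (simp add: algebra_equiv_def)
    then have "\<rho> (ultrafilter_shift G q B) = \<rho> (ultrafilter_shift G q' B)"
      using q B by (auto simp: shifts_by_def)
    then have "ultrafilter_shift G q B \<in> p \<longleftrightarrow> ultrafilter_shift G q' B \<in> p"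
      using tends_to_\<rho>_cong[OF p] d_closure_shift[OF _ B] in\<beta> by blast
    then show ?thesis using strong_Baire_property_d_closure[OF B] by (simp add: mem_conv_iff)
  qed
  then show ?thesis using ellis_map_eq_iff conv_in in\<beta> by blast
qed

text \<open>Only members of \<open>\<D>\<close> enter \<open>tends_to\<close>, so a limit belongs to
  the induced map and not to the chosen ultrafilter.\<close>

lemma ellis_map_tends_to: "F p = F p' \<Longrightarrow> p' \<in> \<beta> \<Longrightarrow> tends_to p a \<Longrightarrow> tends_to p' a"
  using ellis_map_eq_iff[of p p'] by (auto simp: tends_to_def)

section \<open>The ideal \<open>J\<close>, its idempotents and their ideal groups\<close>

abbreviation "E \<equiv> ellis_semigroup G (stone_topology (carrier G) \<A>) (translate_family G)"
abbreviation "cmp \<equiv> compose (topspace (stone_topology (carrier G) \<A>))"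

definition J :: "('a set set \<Rightarrow> 'a set set) set" where
  "J = {F p | p. \<exists>a. tends_to p a}"

lemma E_eq: "E = F ` \<beta>"
  by (rule ellis_semigroup_stone[OF G_algebra])

lemma comp_F: "p \<in> \<beta> \<Longrightarrow> q \<in> \<beta> \<Longrightarrow> cmp (F p) (F q) = F (p \<star> q)"
  by (rule compose_ellis_map[OF _ _ G_algebra])

lemma J_left_ideal: "left_ideal cmp E J"
  unfolding left_ideal_def
proof (intro conjI ballI)
  show "J \<subseteq> E" unfolding E_eq J_def using tends_toD by blast
  show "J \<noteq> {}" using exists_tends_to_one unfolding J_def by blast
  fix s j assume "s \<in> E" "j \<in> J"
  then obtain q p a where q: "q \<in> \<beta>" "s = F q" and p: "tends_to p a" "j = F p"
    unfolding E_eq J_def by blast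
  obtain c where "converges_to q c" using ultrafilter_converges_to[OF q(1)] .
  then have "tends_to (q \<star> p) (c \<otimes> a)" using converges_to_conv_tends_to q p by blast
  then show "cmp s j \<in> J" using p q tends_toD comp_F unfolding J_def by blast
qed

lemma J_right_ideal: "j \<in> J \<Longrightarrow> s \<in> E \<Longrightarrow> cmp j s \<in> J"
proof -
  assume "j \<in> J" "s \<in> E"
  then obtain q p a where q: "q \<in> \<beta>" "s = F q" and p: "tends_to p a" "j = F p"
    unfolding E_eq J_def by blast
  obtain c where "converges_to q c" using ultrafilter_converges_to[OF q(1)] .
  then have "tends_to (p \<star> q) (a \<otimes> c)" using tends_to_conv p q converges_to_shifts_by by blast
  then show "cmp j s \<in> J" using p q tends_toD comp_F unfolding J_def by blast
qed

text \<open>Composing with \<open>F q\<close> on the right acts on \<open>J\<close> as right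
  translation by the limit \<open>b\<close> of \<open>q\<close>, which is undone by first
  translating \<open>p\<close> by the inverse of \<open>b\<close>.\<close>

lemma J_left_simple:
  assumes "i \<in> J" "j \<in> J"
  shows "\<exists>s\<in>E. cmp s j = i"
proof -
  obtain p a q b where p: "tends_to p a" "i = F p" and q: "tends_to q b" "j = F q"
    using assms unfolding J_def by blast
  have b: "b \<in> carrier G" "p \<in> \<beta>" "q \<in> \<beta>" using p q tends_toD by auto
  let ?r = "p \<star> pr (inv b)"
  have r: "tends_to ?r (a \<otimes> inv b)" using p b by (intro tends_to_conv pr_shifts_by) auto
  have "b \<simeq> b" by (simp add: algebra_equiv_def)
  then have "F (?r \<star> q) = F (?r \<star> pr b)"
    using r q b by (intro ellis_map_conv_cong[where b = b and b' = b]) (auto intro: tends_to_shifts_by pr_shifts_by)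
  also have "?r \<star> pr b = p \<star> (pr (inv b) \<star> pr b)" using b by (simp add: conv_assoc pr_in)
  also have "\<dots> = p" using b by (simp add: convolution_principal_principal convolution_principal_one)
  finally have "cmp (F ?r) j = i" using p q b r by (simp add: comp_F tends_toD)
  then show ?thesis using tends_toD(1)[OF r] unfolding E_eq by blast
qed

text \<open>\<open>J\<close> lies in every left ideal \<open>I\<close>: for \<open>i\<close> in
  \<open>J\<close> and \<open>s\<close> in \<open>I\<close>, the product of \<open>i\<close> and
  \<open>s\<close> is in both \<open>J\<close> and \<open>I\<close>, and left simplicity returns
  from it to \<open>i\<close> by a left multiplication.\<close>

lemma minimal_left_ideal_iff: "minimal_left_ideal cmp E I \<longleftrightarrow> I = J"
proof
  have J_least: "J \<subseteq> I" if I: "left_ideal cmp E I" for I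
  proof
    fix i assume i: "i \<in> J"
    obtain s where s: "s \<in> I" "s \<in> E" using I unfolding left_ideal_def by blast
    have "i \<in> E" using i J_left_ideal unfolding left_ideal_def by blast
    have "cmp i s \<in> J" using J_right_ideal i s by blast
    then obtain t where t: "t \<in> E" "cmp t (cmp i s) = i" using J_left_simple i by blast
    have "cmp i s \<in> I" using I s \<open>i \<in> E\<close> unfolding left_ideal_def by blast
    then have "cmp t (cmp i s) \<in> I" using I t(1) unfolding left_ideal_def by blast
    then show "i \<in> I" using t(2) by simp
  qed
  show "minimal_left_ideal cmp E I \<Longrightarrow> I = J"
    using J_left_ideal J_least unfolding minimal_left_ideal_def by blast
  show "I = J \<Longrightarrow> minimal_left_ideal cmp E I"
    using J_left_ideal J_least unfolding minimal_left_ideal_def by blast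
qed

text \<open>Idempotence makes both \<open>a\<close> and \<open>a \<otimes> a\<close> limits of
  \<open>u\<close>; uniqueness modulo \<open>\<simeq>\<close> and cancellation on the left give
  \<open>a \<simeq> \<one>\<close>.\<close>

lemma idempotent_tends_to_one:
  assumes "tends_to u a" "cmp (F u) (F u) = F u"
  shows "tends_to u \<one>"
proof -
  have a: "a \<in> carrier G" "u \<in> \<beta>" using assms tends_toD by auto
  have "tends_to (u \<star> u) (a \<otimes> a)" using assms(1) by (intro tends_to_conv tends_to_shifts_by)
  moreover have "F (u \<star> u) = F u" using assms(2) a by (simp add: comp_F)
  ultimately have "tends_to u (a \<otimes> a)" using ellis_map_tends_to a by blast
  then have "a \<otimes> a \<simeq> a" using tends_to_unique assms(1) by blast
  then have "inv a \<otimes> (a \<otimes> a) \<simeq> inv a \<otimes> a" using a by (intro equiv_left) auto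
  then have "a \<simeq> \<one>" using a by (simp add: m_assoc[symmetric])
  then show ?thesis using assms(1) by (simp add: algebra_equiv_def tends_to_def)
qed

text \<open>All three claims come from one homomorphism \<open>\<psi>\<close>: its image is a group,
  its kernel is normal, and the first isomorphism theorem compares the two.\<close>

lemma ideal_group_iso:
  assumes u: "tends_to u \<one>"
  shows "N_class G T \<A> \<lhd> G" "group (ideal_group cmp J (F u))"
    "ideal_group cmp J (F u) \<cong> G Mod N_class G T \<A>"
proof -
  define \<psi> where "\<psi> g = F (u \<star> pr g)" for g
  let ?H = "ideal_group cmp J (F u)"
  have u\<beta>: "u \<in> \<beta>" using u tends_toD by blast
  have t: "tends_to (u \<star> pr g) g" if "g \<in> carrier G" for g
    using tends_to_conv[OF u pr_shifts_by[OF that]] that by simp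
  have t\<beta>: "u \<star> pr g \<in> \<beta>" if "g \<in> carrier G" for g using t[OF that] tends_toD by blast
  have refl: "g \<simeq> g" for g by (simp add: algebra_equiv_def)
  \<comment> \<open>Next to a left factor that tends to a point, a right factor may be replaced by
    the principal ultrafilter at its limit.\<close>
  have absorb: "F (p \<star> q) = F (p \<star> pr g)" if "tends_to p a" "tends_to q g" for p a q g
    using that refl by (intro ellis_map_conv_cong[where b = g and b' = g])
      (auto intro: tends_to_shifts_by pr_shifts_by tends_toD)
  have carrier: "\<psi> ` carrier G = cmp (F u) ` J"
  proof (intro equalityI subsetI)
    fix f assume "f \<in> cmp (F u) ` J"
    then obtain q b where q: "tends_to q b" "f = cmp (F u) (F q)" unfolding J_def by blast
    then have "f = \<psi> b" using absorb[OF u q(1)] u\<beta> tends_toD by (simp add: comp_F \<psi>_def)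
    then show "f \<in> \<psi> ` carrier G" using q tends_toD by blast
  next
    fix f assume "f \<in> \<psi> ` carrier G"
    then obtain g where g: "g \<in> carrier G" "f = \<psi> g" by blast
    then have "f = cmp (F u) (F (u \<star> pr g))"
      using absorb[OF u t] u\<beta> t\<beta> by (simp add: comp_F \<psi>_def)
    then show "f \<in> cmp (F u) ` J" using t[OF g(1)] unfolding J_def by blast
  qed
  have one: "\<psi> \<one> = F u" using u\<beta> by (simp add: \<psi>_def convolution_principal_one)
  have "\<psi> (g \<otimes> h) = cmp (\<psi> g) (\<psi> h)" if gh: "g \<in> carrier G" "h \<in> carrier G" for g h
  proof -
    have "cmp (\<psi> g) (\<psi> h) = F ((u \<star> pr g) \<star> pr h)"
      using absorb[OF t t] gh t\<beta> by (simp add: \<psi>_def comp_F)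
    also have "\<dots> = \<psi> (g \<otimes> h)"
      using gh by (simp add: conv_assoc[symmetric] pr_in convolution_principal_principal \<psi>_def)
    finally show ?thesis by simp
  qed
  then have hom: "\<psi> \<in> hom G ?H"
    using carrier by (auto simp: hom_def ideal_group_def)
  \<comment> \<open>As the homomorphic image of \<open>G\<close>, the structure is a group without
    any separate construction of inverses.\<close>
  show group_H: "group ?H"
    using hom_imp_img_group[OF hom] by (simp add: carrier one ideal_group_def)
  interpret \<psi>: group_hom G ?H \<psi>
    using group_H hom by (intro group_hom.intro group_hom_axioms.intro) (auto intro: is_group)
  have "\<psi> g = F u \<longleftrightarrow> g \<simeq> \<one>" if g: "g \<in> carrier G" for g
  proof
    assume "\<psi> g = F u"
    then have "tends_to u g" using ellis_map_tends_to t[OF g] u\<beta> unfolding \<psi>_def by blast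
    then show "g \<simeq> \<one>" using tends_to_unique u by blast
  next
    assume "g \<simeq> \<one>"
    then have "\<psi> g = \<psi> \<one>"
      unfolding \<psi>_def by (rule ellis_map_conv_cong[OF u pr_shifts_by[OF g] pr_shifts_by[OF one_closed]])
    then show "\<psi> g = F u" by (simp only: one)
  qed
  then have kernel: "kernel G ?H \<psi> = N_class G T \<A>"
    by (auto simp: kernel_def N_class_def ideal_group_def)
  show normal: "N_class G T \<A> \<lhd> G" using \<psi>.normal_kernel by (simp add: kernel)
  have "G Mod N_class G T \<A> \<cong> ?H"
    using \<psi>.FactGroup_iso_set carrier unfolding kernel
    by (auto intro!: is_isoI simp: ideal_group_def)
  then show "?H \<cong> G Mod N_class G T \<A>"
    using group.iso_sym normal.factorgroup_is_group[OF normal] by blast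
qed

end

theorem theorem4p18:
  fixes G :: "('a, 'm) monoid_scheme" and T :: "'a topology" and \<A> :: "'a set set"
  assumes "compact_topological_group G T"
    and "G_algebra G \<A>"
    and "\<And>A. A \<in> \<A> \<Longrightarrow> strong_Baire_property T A"
  shows "N_class G T \<A> \<lhd> G \<and>
         ellis_group_iso G (stone_topology (carrier G) \<A>) (translate_family G)
           (G Mod N_class G T \<A>)"
proof -
  interpret strong_Baire_G_algebra G T \<A>
    using assms by (intro strong_Baire_G_algebra.intro strong_Baire_G_algebra_axioms.intro)
      (auto simp: compact_topological_group_def)
  obtain u where u: "tends_to u \<one>\<^bsub>G\<^esub>" using exists_tends_to_one by blast
  have u\<beta>: "u \<in> \<beta>" using u tends_toD by blast
  \<comment> \<open>Since \<open>u\<close> tends to the identity, convolving with \<open>u\<close>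
    on the right has the effect of the principal ultrafilter of the identity, so \<open>F u\<close>
    is an idempotent of \<open>J\<close>.\<close>
  have "F (u \<star> u) = F (u \<star> pr \<one>\<^bsub>G\<^esub>)"
    using u by (intro ellis_map_conv_cong[where b = "\<one>\<^bsub>G\<^esub>" and b' = "\<one>\<^bsub>G\<^esub>"])
      (auto intro: tends_to_shifts_by pr_shifts_by simp: algebra_equiv_def)
  then have "cmp (F u) (F u) = F u"
    using u\<beta> by (simp add: comp_F convolution_principal_one)
  moreover have "F u \<in> J" using u unfolding J_def by blast
  moreover have "group (ideal_group cmp J v) \<and> ideal_group cmp J v \<cong> G Mod N_class G T \<A>"
    if v: "v \<in> J" "cmp v v = v" for v
  proof -
    obtain p a where p: "tends_to p a" "v = F p" using v(1) unfolding J_def by blast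
    then have "tends_to p \<one>\<^bsub>G\<^esub>" using v(2) idempotent_tends_to_one by blast
    then show ?thesis using ideal_group_iso p(2) by blast
  qed
  ultimately have "ellis_group_iso G (stone_topology (carrier G) \<A>) (translate_family G)
      (G Mod N_class G T \<A>)"
    unfolding ellis_group_iso_def Let_def minimal_left_ideal_iff by blast
  then show ?thesis using ideal_group_iso(1)[OF u] by blast
qed

end
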